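(* Let $m\geqslant 2$, let $B$ be a simple Lie algebra over a field $F$, suppose $F$ contains a primitive $m$th root of unity $\zeta$, and let $\alpha\in F$, $\alpha\ne 0$. Then $$L\left(B,\frac{1}{\alpha^m(1-\zeta)^m}\right)\cong L_\alpha(B)$$ as $H_{m^2}(\zeta)$-module Lie algebras.
   Context: The Taft algebra $H_{m^2}(\zeta)$ is the unital associative $F$-algebra generated by $c,v$ with relations $c^m=1$, $v^m=0$, $vc=\zeta cv$; it is a Hopf algebra with $\Delta(c)=c\otimes c$, $\Delta(v)=c\otimes v+v\otimes 1$, $\varepsilon(c)=1$, $\varepsilon(v)=0$, $S(c)=c^{-1}$, $S(v)=-c^{-1}v$. An $H_{m^2}(\zeta)$-module Lie algebra is a Lie algebra $L$ over $F$ that is a left $H_{m^2}(\zeta)$-module with $h[a,b]=[h_{(1)}a,h_{(2)}b]$ for all $h$ and all $a,b\in L$. Isomorphisms of such algebras are Lie algebra isomorphisms that are also $H_{m^2}(\zeta)$-module maps. Definition of $L_\alpha(B)$: $L_\alpha(B):=B\oplus\dots\oplus B$ ($m$ copies, direct sum of ideals) with $$c(a_1,a_2,\ldots,a_m)=(a_m,a_1,a_2,\ldots,a_{m-1}),$$ $$v(a_1,\ldots,a_m)=\alpha\left(a_1-a_m,\ \zeta(a_2-a_1),\ \ldots,\ \zeta^{m-1}(a_m-a_{m-1})\right).$$ Quantum notation: $n_\zeta:=1+\zeta+\dots+\zeta^{n-1}$, $n!_\zeta:=n_\zeta(n-1)_\zeta\cdots 1_\zeta$, $0!_\zeta:=1$,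 $\binom{n}{k}_\zeta:=\dfrac{n!_\zeta}{(n-k)!_\zeta\,k!_\zeta}$, $\binom n0_\zeta=\binom nn_\zeta:=1$. Definition of $L(B,\gamma)$ for $\gamma\in F$: let $L^{(0)}:=B$, let $L^{(1)},\ldots,L^{(m-1)}$ be vector spaces with $F$-linear bijections $\varphi\colon L^{(i-1)}\to L^{(i)}$, $1\leqslant i\leqslant m-1$, and put $\varphi(L^{(m-1)}):=0$. Then $L(B,\gamma):=\bigoplus_{i=0}^{m-1}L^{(i)}$ with $v\varphi(a)=a$ for $a\in L^{(i)}$, $0\leqslant i\leqslant m-2$, $vB=0$, $ca^{(i)}=\zeta^ia^{(i)}$ for $a^{(i)}\in L^{(i)}$, and for $a,b\in B$, $0\leqslant k,\ell<m$, $$[\varphi^k(a),\varphi^\ell(b)]:=\begin{cases}\binom{k+\ell}{k}_\zeta\,\varphi^{k+\ell}[a,b] & \text{if } k+\ell<m,\\[4pt] \gamma\,\dfrac{(k+\ell-m)!_\zeta}{k!_\zeta\,\ell!_\zeta}\,\varphi^{k+\ell-m}[a,b] & \text{if } k+\ell\geqslant m.\end{cases}$$ Both $L_\alpha(B)$ and $L(B,\gamma)$ are $H_{m^2}(\zeta)$-module Lie algebras. *)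

theory Defs
  imports Complex_Main "HOL-Library.Poly_Mapping" "HOL-Library.Product_Plus" "HOL-Library.Function_Algebras"
    "HOL-Algebra.QuotRing"
begin

section \<open>Lie algebras\<close>

text \<open>Addition is that of the ambient type; the Lie algebra itself lives on a subspace
  \<open>carrier\<close> of the ambient vector space.\<close>

record ('f, 'a) lie_struct = "'a partial_object" +
  smul :: "'f \<Rightarrow> 'a \<Rightarrow> 'a"
  bracket :: "'a \<Rightarrow> 'a \<Rightarrow> 'a"

locale lie_algebra =
  fixes L :: "('f::field, 'a::ab_group_add, 'x) lie_struct_scheme"
  assumes vector_space: "vector_space (smul L)"
    and subspace: "module.subspace (smul L) (carrier L)"
    and bracket_closed: "\<lbrakk>x \<in> carrier L; y \<in> carrier L\<rbrakk> \<Longrightarrow> bracket L x y \<in> carrier L"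
    and bracket_add_left: "\<lbrakk>x \<in> carrier L; y \<in> carrier L; z \<in> carrier L\<rbrakk> \<Longrightarrow>
      bracket L (x + y) z = bracket L x z + bracket L y z"
    and bracket_add_right: "\<lbrakk>x \<in> carrier L; y \<in> carrier L; z \<in> carrier L\<rbrakk> \<Longrightarrow>
      bracket L x (y + z) = bracket L x y + bracket L x z"
    and bracket_smul_left: "\<lbrakk>x \<in> carrier L; y \<in> carrier L\<rbrakk> \<Longrightarrow>
      bracket L (smul L r x) y = smul L r (bracket L x y)"
    and bracket_smul_right: "\<lbrakk>x \<in> carrier L; y \<in> carrier L\<rbrakk> \<Longrightarrow>
      bracket L x (smul L r y) = smul L r (bracket L x y)"
    and bracket_self: "x \<in> carrier L \<Longrightarrow> bracket L x x = 0"
    and jacobi: "\<lbrakk>x \<in> carrier L; y \<in> carrier L; z \<in> carrier L\<rbrakk> \<Longrightarrow>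
      bracket L x (bracket L y z) + bracket L y (bracket L z x) + bracket L z (bracket L x y) = 0"

definition lie_ideal :: "'a set \<Rightarrow> ('f::field, 'a::ab_group_add, 'x) lie_struct_scheme \<Rightarrow> bool" where
  "lie_ideal I L \<longleftrightarrow> I \<subseteq> carrier L \<and> module.subspace (smul L) I \<and>
     (\<forall>x\<in>carrier L. \<forall>y\<in>I. bracket L x y \<in> I)"

locale simple_lie_algebra = lie_algebra +
  assumes nonabelian: "\<exists>x\<in>carrier L. \<exists>y\<in>carrier L. bracket L x y \<noteq> 0"
    and ideals: "lie_ideal I L \<Longrightarrow> I = {0} \<or> I = carrier L"

definition linear_on_sub ::
    "('f \<Rightarrow> 'a \<Rightarrow> 'a::ab_group_add) \<Rightarrow> ('f \<Rightarrow> 'b \<Rightarrow> 'b::ab_group_add) \<Rightarrow> 'a set \<Rightarrow> ('a \<Rightarrow> 'b) \<Rightarrow> bool" where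
  "linear_on_sub s t V f \<longleftrightarrow>
     (\<forall>x\<in>V. \<forall>y\<in>V. f (x + y) = f x + f y) \<and> (\<forall>r. \<forall>x\<in>V. f (s r x) = t r (f x))"

section \<open>The Taft algebra\<close>

definition primitive_root_of_unity :: "nat \<Rightarrow> 'f::field \<Rightarrow> bool" where
  "primitive_root_of_unity m \<zeta> \<longleftrightarrow> \<zeta> ^ m = 1 \<and> (\<forall>k. 0 < k \<and> k < m \<longrightarrow> \<zeta> ^ k \<noteq> 1)"

datatype taft_gen = Gen_c | Gen_v

text \<open>The free monoid on the two generators is written additively, so that
  \<open>taft_word \<Rightarrow>\<^sub>0 'f\<close> with the convolution product of \<open>HOL-Library.Poly_Mapping\<close>
  is the free unital associative algebra on them, and
  \<open>taft_word \<times> taft_word \<Rightarrow>\<^sub>0 'f\<close> is the tensor square of that algebra.\<close>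

datatype taft_word = Word (letters: "taft_gen list")

instantiation taft_word :: monoid_add
begin

definition zero_taft_word :: taft_word where "0 = Word []"

definition plus_taft_word :: "taft_word \<Rightarrow> taft_word \<Rightarrow> taft_word" where
  "u + w = Word (letters u @ letters w)"

instance
  by standard (simp_all add: zero_taft_word_def plus_taft_word_def)

end

type_synonym 'f taft_free = "taft_word \<Rightarrow>\<^sub>0 'f"

definition free_gen :: "taft_gen \<Rightarrow> 'f::field taft_free" where
  "free_gen g = Poly_Mapping.single (Word [g]) 1"

definition free_const :: "'f::field \<Rightarrow> 'f taft_free" where
  "free_const r = Poly_Mapping.single 0 r"

definition free_ring :: "'f::field taft_free ring" where
  "free_ring = \<lparr>carrier = UNIV, monoid.mult = (*), one = 1, ring.zero = 0, add = (+)\<rparr>"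

definition taft_relations :: "nat \<Rightarrow> 'f::field \<Rightarrow> 'f taft_free set" where
  "taft_relations m \<zeta> =
     {free_gen Gen_c ^ m - 1,
      free_gen Gen_v ^ m,
      free_gen Gen_v * free_gen Gen_c - free_const \<zeta> * (free_gen Gen_c * free_gen Gen_v)}"

definition taft_ideal :: "nat \<Rightarrow> 'f::field \<Rightarrow> 'f taft_free set" where
  "taft_ideal m \<zeta> = Idl\<^bsub>free_ring\<^esub> (taft_relations m \<zeta>)"

definition taft_algebra :: "nat \<Rightarrow> 'f::field \<Rightarrow> 'f taft_free set ring" where
  "taft_algebra m \<zeta> = free_ring Quot (taft_ideal m \<zeta>)"

definition taft_class :: "nat \<Rightarrow> 'f::field \<Rightarrow> 'f taft_free \<Rightarrow> 'f taft_free set" where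
  "taft_class m \<zeta> p = taft_ideal m \<zeta> +>\<^bsub>free_ring\<^esub> p"

fun delta_gen :: "taft_gen \<Rightarrow> (taft_word \<times> taft_word) \<Rightarrow>\<^sub>0 'f::field" where
  "delta_gen Gen_c = Poly_Mapping.single (Word [Gen_c], Word [Gen_c]) 1"
| "delta_gen Gen_v = Poly_Mapping.single (Word [Gen_c], Word [Gen_v]) 1
     + Poly_Mapping.single (Word [Gen_v], 0) 1"

text \<open>The comultiplication, lifted to the free algebra as the algebra homomorphism
  with the prescribed values on the generators. For \<open>h\<close> the class of \<open>p\<close> the element
  \<open>\<Delta>(h)\<close> is the sum of \<open>z\<^bsub>u,w\<^esub> [u] \<otimes> [w]\<close>, where \<open>z\<^bsub>u,w\<^esub>\<close> are the coefficients of
  \<open>free_delta p\<close>.\<close>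

definition free_delta :: "'f::field taft_free \<Rightarrow> (taft_word \<times> taft_word) \<Rightarrow>\<^sub>0 'f" where
  "free_delta p = (\<Sum>w\<in>Poly_Mapping.keys p.
     Poly_Mapping.single 0 (Poly_Mapping.lookup p w) * prod_list (map delta_gen (letters w)))"

section \<open>Module Lie algebras over the Taft algebra\<close>

record (overloaded) ('f::zero, 'a) taft_lie_struct = "('f, 'a) lie_struct" +
  act :: "'f taft_free set \<Rightarrow> 'a \<Rightarrow> 'a"

text \<open>In \<open>act_bracket\<close> the identity \<open>h[a,b] = [h\<^sub>1 a, h\<^sub>2 b]\<close> (Sweedler notation) is required for every
  representative \<open>p\<close> of \<open>h\<close>.\<close>

locale taft_module_lie_algebra = lie_algebra M
  for m :: nat and \<zeta> :: "'f::field"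
    and M :: "('f, 'a::ab_group_add, 'x) taft_lie_struct_scheme" +
  assumes act_closed: "\<lbrakk>h \<in> carrier (taft_algebra m \<zeta>); x \<in> carrier M\<rbrakk> \<Longrightarrow> act M h x \<in> carrier M"
    and act_add: "\<lbrakk>h \<in> carrier (taft_algebra m \<zeta>); x \<in> carrier M; y \<in> carrier M\<rbrakk> \<Longrightarrow>
      act M h (x + y) = act M h x + act M h y"
    and add_act: "\<lbrakk>h \<in> carrier (taft_algebra m \<zeta>); k \<in> carrier (taft_algebra m \<zeta>); x \<in> carrier M\<rbrakk> \<Longrightarrow>
      act M (h \<oplus>\<^bsub>taft_algebra m \<zeta>\<^esub> k) x = act M h x + act M k x"
    and mult_act: "\<lbrakk>h \<in> carrier (taft_algebra m \<zeta>); k \<in> carrier (taft_algebra m \<zeta>); x \<in> carrier M\<rbrakk> \<Longrightarrow>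
      act M (h \<otimes>\<^bsub>taft_algebra m \<zeta>\<^esub> k) x = act M h (act M k x)"
    and one_act: "x \<in> carrier M \<Longrightarrow> act M \<one>\<^bsub>taft_algebra m \<zeta>\<^esub> x = x"
    and const_act: "x \<in> carrier M \<Longrightarrow> act M (taft_class m \<zeta> (free_const r)) x = smul M r x"
    and act_bracket: "\<lbrakk>h \<in> carrier (taft_algebra m \<zeta>); p \<in> h; a \<in> carrier M; b \<in> carrier M\<rbrakk> \<Longrightarrow>
      act M h (bracket M a b) =
        (\<Sum>(u, w)\<in>Poly_Mapping.keys (free_delta p).
           smul M (Poly_Mapping.lookup (free_delta p) (u, w))
             (bracket M (act M (taft_class m \<zeta> (Poly_Mapping.single u 1)) a)
                        (act M (taft_class m \<zeta> (Poly_Mapping.single w 1)) b)))"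

definition taft_lie_iso :: "nat \<Rightarrow> 'f::field \<Rightarrow> ('f, 'a::ab_group_add) taft_lie_struct \<Rightarrow>
    ('f, 'b::ab_group_add) taft_lie_struct \<Rightarrow> ('a \<Rightarrow> 'b) \<Rightarrow> bool" where
  "taft_lie_iso m \<zeta> M N f \<longleftrightarrow>
     bij_betw f (carrier M) (carrier N) \<and>
     linear_on_sub (smul M) (smul N) (carrier M) f \<and>
     (\<forall>x\<in>carrier M. \<forall>y\<in>carrier M. f (bracket M x y) = bracket N (f x) (f y)) \<and>
     (\<forall>h\<in>carrier (taft_algebra m \<zeta>). \<forall>x\<in>carrier M. f (act M h x) = act N h (f x))"

definition taft_lie_isomorphic :: "nat \<Rightarrow> 'f::field \<Rightarrow> ('f, 'a::ab_group_add) taft_lie_struct \<Rightarrow>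
    ('f, 'b::ab_group_add) taft_lie_struct \<Rightarrow> bool" where
  "taft_lie_isomorphic m \<zeta> M N \<longleftrightarrow>
     taft_module_lie_algebra m \<zeta> M \<and> taft_module_lie_algebra m \<zeta> N \<and>
     (\<exists>f. taft_lie_iso m \<zeta> M N f)"

text \<open>The action of the free algebra in which the generators act by given operators.\<close>

definition free_act ::
    "('f::field \<Rightarrow> 'a \<Rightarrow> 'a::ab_group_add) \<Rightarrow> (taft_gen \<Rightarrow> 'a \<Rightarrow> 'a) \<Rightarrow> 'f taft_free \<Rightarrow> 'a \<Rightarrow> 'a" where
  "free_act s T p x =
     (\<Sum>w\<in>Poly_Mapping.keys p. s (Poly_Mapping.lookup p w) (foldr T (letters w) x))"

text \<open>The induced action of a residue class, through an arbitrary representative. It does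
  not depend on the representative when the operators satisfy the Taft relations.\<close>

definition gen_act ::
    "('f::field \<Rightarrow> 'a \<Rightarrow> 'a::ab_group_add) \<Rightarrow> ('a \<Rightarrow> 'a) \<Rightarrow> ('a \<Rightarrow> 'a) \<Rightarrow> 'f taft_free set \<Rightarrow> 'a \<Rightarrow> 'a" where
  "gen_act s C V h = free_act s (case_taft_gen C V) (SOME p. p \<in> h)"

section \<open>The algebras \<open>L\<^sub>\<alpha>(B)\<close> and \<open>L(B, \<gamma>)\<close>\<close>

text \<open>A direct sum of \<open>m\<close> spaces \<open>V 0, \<dots>, V (m - 1)\<close> consists of the sequences vanishing
  from index \<open>m\<close> on; all indices are counted from \<open>0\<close>.\<close>

definition dsum :: "nat \<Rightarrow> (nat \<Rightarrow> 'b::zero set) \<Rightarrow> (nat \<Rightarrow> 'b) set" where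
  "dsum m V = {x. (\<forall>i<m. x i \<in> V i) \<and> (\<forall>i\<ge>m. x i = 0)}"

definition dsum_smul :: "('f \<Rightarrow> 'b \<Rightarrow> 'b) \<Rightarrow> 'f \<Rightarrow> (nat \<Rightarrow> 'b) \<Rightarrow> nat \<Rightarrow> 'b" where
  "dsum_smul s r x = (\<lambda>i. s r (x i))"

definition L_alpha_c :: "nat \<Rightarrow> (nat \<Rightarrow> 'b::ab_group_add) \<Rightarrow> nat \<Rightarrow> 'b" where
  "L_alpha_c m a = (\<lambda>i. if i < m then (if i = 0 then a (m - 1) else a (i - 1)) else 0)"

definition L_alpha_v :: "nat \<Rightarrow> 'f::field \<Rightarrow> 'f \<Rightarrow> ('f \<Rightarrow> 'b \<Rightarrow> 'b) \<Rightarrow> (nat \<Rightarrow> 'b::ab_group_add) \<Rightarrow> nat \<Rightarrow> 'b" where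
  "L_alpha_v m \<zeta> \<alpha> s a =
     (\<lambda>i. if i < m then s \<alpha> (s (\<zeta> ^ i) (a i - (if i = 0 then a (m - 1) else a (i - 1)))) else 0)"

definition L_alpha :: "nat \<Rightarrow> 'f::field \<Rightarrow> 'f \<Rightarrow> ('f, 'b::ab_group_add) lie_struct \<Rightarrow>
    ('f, nat \<Rightarrow> 'b) taft_lie_struct" where
  "L_alpha m \<zeta> \<alpha> B =
     \<lparr>carrier = dsum m (\<lambda>i. carrier B),
      smul = dsum_smul (smul B),
      bracket = (\<lambda>a b i. if i < m then bracket B (a i) (b i) else 0),
      act = gen_act (dsum_smul (smul B)) (L_alpha_c m) (L_alpha_v m \<zeta> \<alpha> (smul B))\<rparr>"

definition qnum :: "'f::field \<Rightarrow> nat \<Rightarrow> 'f" where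
  "qnum \<zeta> n = (\<Sum>i<n. \<zeta> ^ i)"

definition qfact :: "'f::field \<Rightarrow> nat \<Rightarrow> 'f" where
  "qfact \<zeta> n = (\<Prod>i=1..n. qnum \<zeta> i)"

definition qbinom :: "'f::field \<Rightarrow> nat \<Rightarrow> nat \<Rightarrow> 'f" where
  "qbinom \<zeta> n k =
     (if k = 0 \<or> k = n then 1 else qfact \<zeta> n / (qfact \<zeta> (n - k) * qfact \<zeta> k))"

text \<open>The spaces \<open>L\<^bsup>(0)\<^esup> = B, \<dots>, L\<^bsup>(m-1)\<^esup>\<close>, as subspaces (not necessarily independent or
  distinct) of one ambient vector space, with the linear bijections
  \<open>\<phi> i : L\<^bsup>(i-1)\<^esup> \<rightarrow> L\<^bsup>(i)\<^esup>\<close>.\<close>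

definition phi_data :: "nat \<Rightarrow> ('f::field, 'b::ab_group_add) lie_struct \<Rightarrow> (nat \<Rightarrow> 'b set) \<Rightarrow>
    (nat \<Rightarrow> 'b \<Rightarrow> 'b) \<Rightarrow> bool" where
  "phi_data m B L \<phi> \<longleftrightarrow>
     L 0 = carrier B \<and>
     (\<forall>i<m. module.subspace (smul B) (L i)) \<and>
     (\<forall>i. 1 \<le> i \<and> i < m \<longrightarrow>
        bij_betw (\<phi> i) (L (i - 1)) (L i) \<and> linear_on_sub (smul B) (smul B) (L (i - 1)) (\<phi> i))"

text \<open>The map \<open>\<phi>\<close> on the whole direct sum, including \<open>\<phi>(L\<^bsup>(m-1)\<^esup>) = 0\<close>.\<close>

definition Phi :: "nat \<Rightarrow> (nat \<Rightarrow> 'b \<Rightarrow> 'b) \<Rightarrow> (nat \<Rightarrow> 'b::ab_group_add) \<Rightarrow> nat \<Rightarrow> 'b" where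
  "Phi m \<phi> x = (\<lambda>i. if 1 \<le> i \<and> i < m then \<phi> i (x (i - 1)) else 0)"

definition emb0 :: "'b::zero \<Rightarrow> nat \<Rightarrow> 'b" where
  "emb0 a = (\<lambda>i. if i = 0 then a else 0)"

definition phi_pow :: "nat \<Rightarrow> (nat \<Rightarrow> 'b \<Rightarrow> 'b) \<Rightarrow> nat \<Rightarrow> 'b::ab_group_add \<Rightarrow> nat \<Rightarrow> 'b" where
  "phi_pow m \<phi> k a = (Phi m \<phi> ^^ k) (emb0 a)"

text \<open>For \<open>x\<close> in the direct sum, \<open>phi_coord m B \<phi> k x\<close> is the \<open>a\<^sub>k \<in> B\<close> in the unique expression
  of \<open>x\<close> as the sum of \<open>\<phi>\<^sup>k(a\<^sub>k)\<close> over \<open>k < m\<close>; \<open>L_gamma_bracket\<close> is the bilinear extension of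
  the prescribed brackets of the elements \<open>\<phi>\<^sup>k(a)\<close>.\<close>

definition phi_coord :: "nat \<Rightarrow> ('f, 'b::ab_group_add) lie_struct \<Rightarrow> (nat \<Rightarrow> 'b \<Rightarrow> 'b) \<Rightarrow> nat \<Rightarrow>
    (nat \<Rightarrow> 'b) \<Rightarrow> 'b" where
  "phi_coord m B \<phi> k x = inv_into (carrier B) (\<lambda>a. phi_pow m \<phi> k a k) (x k)"

definition L_gamma_bracket :: "nat \<Rightarrow> 'f::field \<Rightarrow> 'f \<Rightarrow> ('f, 'b::ab_group_add) lie_struct \<Rightarrow>
    (nat \<Rightarrow> 'b \<Rightarrow> 'b) \<Rightarrow> (nat \<Rightarrow> 'b) \<Rightarrow> (nat \<Rightarrow> 'b) \<Rightarrow> nat \<Rightarrow> 'b" where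
  "L_gamma_bracket m \<zeta> \<gamma> B \<phi> x y =
     (\<Sum>k<m. \<Sum>l<m.
        let ab = bracket B (phi_coord m B \<phi> k x) (phi_coord m B \<phi> l y)
        in if k + l < m
           then dsum_smul (smul B) (qbinom \<zeta> (k + l) k) (phi_pow m \<phi> (k + l) ab)
           else dsum_smul (smul B) (\<gamma> * (qfact \<zeta> (k + l - m) / (qfact \<zeta> k * qfact \<zeta> l)))
                  (phi_pow m \<phi> (k + l - m) ab))"

definition L_gamma_c :: "nat \<Rightarrow> 'f::field \<Rightarrow> ('f \<Rightarrow> 'b \<Rightarrow> 'b) \<Rightarrow> (nat \<Rightarrow> 'b::ab_group_add) \<Rightarrow> nat \<Rightarrow> 'b" where
  "L_gamma_c m \<zeta> s x = (\<lambda>i. if i < m then s (\<zeta> ^ i) (x i) else 0)"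

definition L_gamma_v :: "nat \<Rightarrow> (nat \<Rightarrow> 'b set) \<Rightarrow> (nat \<Rightarrow> 'b \<Rightarrow> 'b) \<Rightarrow> (nat \<Rightarrow> 'b::ab_group_add) \<Rightarrow> nat \<Rightarrow> 'b" where
  "L_gamma_v m L \<phi> x = (\<lambda>i. if i + 1 < m then inv_into (L i) (\<phi> (i + 1)) (x (i + 1)) else 0)"

definition L_gamma :: "nat \<Rightarrow> 'f::field \<Rightarrow> 'f \<Rightarrow> ('f, 'b::ab_group_add) lie_struct \<Rightarrow>
    (nat \<Rightarrow> 'b set) \<Rightarrow> (nat \<Rightarrow> 'b \<Rightarrow> 'b) \<Rightarrow> ('f, nat \<Rightarrow> 'b) taft_lie_struct" where
  "L_gamma m \<zeta> \<gamma> B L \<phi> =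
     \<lparr>carrier = dsum m L,
      smul = dsum_smul (smul B),
      bracket = L_gamma_bracket m \<zeta> \<gamma> B \<phi>,
      act = gen_act (dsum_smul (smul B)) (L_gamma_c m \<zeta> (smul B)) (L_gamma_v m L \<phi>)\<rparr>"

end

theory Submission
  imports Defs "HOL-Computational_Algebra.Polynomial"
begin

text \<open>The space \<open>L\<^sub>\<alpha>(B)\<close> decomposes into the eigenspaces of \<open>c\<close>: the
  \<open>\<zeta>\<^sup>k\<close>-eigenvectors are \<open>u\<^sub>k(a) = (\<zeta>\<^bsup>-ik\<^esup> a)\<^sub>i\<close> with \<open>a \<in> B\<close>. They satisfy
  \<open>v u\<^sub>k(a) = \<alpha> (1 - \<zeta>\<^sup>k) u\<^bsub>k-1\<^esub>(a)\<close> and \<open>[u\<^sub>k(a), u\<^sub>l(b)] = u\<^bsub>k+l\<^esub>[a, b]\<close>, where indices are read modulo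
  \<open>m\<close>. With \<open>\<beta> = \<alpha> (1 - \<zeta>)\<close> the first identity forces \<open>\<phi>\<^sup>k(a) \<mapsto> u\<^sub>k(a) / (\<beta>\<^sup>k k!\<^sub>\<zeta>)\<close>, and the second
  turns into the bracket of \<open>L(B, \<beta>\<^bsup>-m\<^esup>)\<close>. The map is bijective by Fourier inversion, as \<open>m \<noteq> 0\<close>
  in a field with a primitive \<open>m\<close>th root of unity.\<close>

section \<open>Algebras with operators satisfying the Taft relations\<close>

text \<open>Updating at a key outside the support is the same as adding a \<open>single\<close>. The
  additive form suits the maps \<open>free_act\<close>, \<open>tensor_act\<close> and
  \<open>free_delta\<close>: they are additive, so identities between them need checking on single
  terms only.\<close>

lemma poly_mapping_add_single_induct [case_names zero add_single]:
  fixes p :: "'a \<Rightarrow>\<^sub>0 'b::monoid_add"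
  assumes "P 0" and "\<And>p k r. P p \<Longrightarrow> P (p + Poly_Mapping.single k r)"
  shows "P p"
proof (induction p rule: update_induct)
  case (update p k r)
  have "Poly_Mapping.update k r p = p + Poly_Mapping.single k r"
    using update(1)
    by (intro poly_mapping_eqI)
      (auto simp: Poly_Mapping.lookup_update lookup_add lookup_single in_keys_iff when_def)
  then show ?case
    using assms(2) update by simp
qed (rule assms)

section \<open>The free algebra on two generators and its Taft quotient\<close>

lemma taft_word_plus [simp]: "letters (u + w) = letters u @ letters w"
  by (simp add: plus_taft_word_def)

lemma taft_word_zero [simp]: "letters 0 = []"
  by (simp add: zero_taft_word_def)

lemma ring_free_ring: "ring (free_ring :: 'f::field taft_free ring)"
proof (rule ringI)
  show "abelian_group (free_ring :: 'f taft_free ring)"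
  proof (rule abelian_groupI)
    fix x :: "'f taft_free"
    show "\<exists>y\<in>carrier free_ring. y \<oplus>\<^bsub>free_ring\<^esub> x = \<zero>\<^bsub>free_ring\<^esub>"
      by (intro bexI[of _ "- x"]) (auto simp: free_ring_def)
  qed (auto simp: free_ring_def algebra_simps)
  show "Group.monoid (free_ring :: 'f taft_free ring)"
    by (rule monoidI) (auto simp: free_ring_def algebra_simps)
qed (auto simp: free_ring_def algebra_simps)

lemma a_inv_free_ring [simp]: "\<ominus>\<^bsub>free_ring\<^esub> (p :: 'f::field taft_free) = - p"
proof -
  interpret ring "free_ring :: 'f taft_free ring" by (rule ring_free_ring)
  show ?thesis
    by (rule minus_equality) (auto simp: free_ring_def)
qed

lemma ideal_taft_ideal: "ideal (taft_ideal m \<zeta>) (free_ring :: 'f::field taft_free ring)"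
  unfolding taft_ideal_def
  by (rule ring.genideal_ideal[OF ring_free_ring]) (simp add: free_ring_def)

text \<open>Closure under negation follows from absorption of the factor \<open>- 1\<close>.\<close>

lemma ideal_free_ringI:
  fixes I :: "'f::field taft_free set"
  assumes "0 \<in> I" "\<And>p q. p \<in> I \<Longrightarrow> q \<in> I \<Longrightarrow> p + q \<in> I"
    and "\<And>p q. q \<in> I \<Longrightarrow> p * q \<in> I" "\<And>p q. p \<in> I \<Longrightarrow> p * q \<in> I"
  shows "ideal I free_ring"
proof (rule idealI[OF ring_free_ring])
  interpret ring "free_ring :: 'f taft_free ring" by (rule ring_free_ring)
  show "subgroup I (add_monoid free_ring)"
  proof (rule add.subgroupI)
    show "\<ominus>\<^bsub>free_ring\<^esub> p \<in> I" if "p \<in> I" for p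
      using assms(3)[OF that, of "- 1"] by simp
  qed (use assms in \<open>auto simp: free_ring_def\<close>)
qed (use assms in \<open>auto simp: free_ring_def\<close>)

lemma carrier_taft_algebra: "carrier (taft_algebra m \<zeta>) = range (taft_class m \<zeta>)"
  by (auto simp: taft_algebra_def FactRing_def A_RCOSETS_def' taft_class_def free_ring_def)

lemma taft_class_add:
  "taft_class m \<zeta> p \<oplus>\<^bsub>taft_algebra m \<zeta>\<^esub> taft_class m \<zeta> q = taft_class m \<zeta> (p + q)"
  using ideal.a_rcos_sum[OF ideal_taft_ideal, of p q m \<zeta>]
  by (simp add: taft_algebra_def FactRing_def taft_class_def free_ring_def)

lemma taft_class_mult:
  "taft_class m \<zeta> p \<otimes>\<^bsub>taft_algebra m \<zeta>\<^esub> taft_class m \<zeta> q = taft_class m \<zeta> (p * q)"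
  using ideal.rcoset_mult_add[OF ideal_taft_ideal, of p q m \<zeta>]
  by (simp add: taft_algebra_def FactRing_def taft_class_def free_ring_def)

lemma taft_class_one: "\<one>\<^bsub>taft_algebra m \<zeta>\<^esub> = taft_class m \<zeta> 1"
  by (simp add: taft_algebra_def FactRing_def taft_class_def free_ring_def)

lemma taft_class_self: "p \<in> taft_class m \<zeta> p"
proof -
  interpret ideal "taft_ideal m \<zeta>" free_ring by (rule ideal_taft_ideal)
  show ?thesis
    unfolding taft_class_def by (rule a_rcos_self) (simp add: free_ring_def)
qed

lemma taft_class_diff: "q \<in> taft_class m \<zeta> p \<Longrightarrow> q - p \<in> taft_ideal m \<zeta>"
  by (auto simp: taft_class_def a_r_coset_def' free_ring_def)

section \<open>Closure and bilinearity in a Lie algebra that lives on a subspace\<close>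

sublocale lie_algebra \<subseteq> vs: vector_space "smul L"
  by (rule vector_space)

context lie_algebra
begin

lemma zero_closed: "0 \<in> carrier L"
  using subspace by (rule vs.subspace_0)

lemma add_closed: "x \<in> carrier L \<Longrightarrow> y \<in> carrier L \<Longrightarrow> x + y \<in> carrier L"
  using subspace by (rule vs.subspace_add)

lemma smul_closed: "x \<in> carrier L \<Longrightarrow> smul L r x \<in> carrier L"
  using subspace by (rule vs.subspace_scale)

lemma sum_closed: "(\<And>i. i \<in> I \<Longrightarrow> f i \<in> carrier L) \<Longrightarrow> sum f I \<in> carrier L"
  using subspace by (rule vs.subspace_sum)

lemma bracket_zero_left [simp]: "x \<in> carrier L \<Longrightarrow> bracket L 0 x = 0"
  using bracket_add_left[of 0 0 x] zero_closed by simp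

lemma bracket_zero_right [simp]: "x \<in> carrier L \<Longrightarrow> bracket L x 0 = 0"
  using bracket_add_right[of x 0 0] zero_closed by simp

lemma bracket_sum_left:
  "\<lbrakk>\<And>i. i \<in> I \<Longrightarrow> f i \<in> carrier L; y \<in> carrier L\<rbrakk> \<Longrightarrow>
    bracket L (sum f I) y = (\<Sum>i\<in>I. bracket L (f i) y)"
  by (induction I rule: infinite_finite_induct) (auto simp: bracket_add_left sum_closed)

lemma bracket_sum_right:
  "\<lbrakk>\<And>i. i \<in> I \<Longrightarrow> f i \<in> carrier L; y \<in> carrier L\<rbrakk> \<Longrightarrow>
    bracket L y (sum f I) = (\<Sum>i\<in>I. bracket L y (f i))"
  by (induction I rule: infinite_finite_induct) (auto simp: bracket_add_right sum_closed)

end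

section \<open>The action of the free algebra through linear operators on a subspace\<close>

locale linear_operator_family = vector_space s
  for s :: "'f::field \<Rightarrow> 'a \<Rightarrow> 'a::ab_group_add" +
  fixes A :: "'a set" and T :: "taft_gen \<Rightarrow> 'a \<Rightarrow> 'a"
  assumes subspace_A: "subspace A"
    and T_closed: "x \<in> A \<Longrightarrow> T g x \<in> A"
    and T_linear: "linear_on_sub s s A (T g)"
begin

lemma T_add: "x \<in> A \<Longrightarrow> y \<in> A \<Longrightarrow> T g (x + y) = T g x + T g y"
  using T_linear[of g] by (simp add: linear_on_sub_def)

lemma T_scale: "x \<in> A \<Longrightarrow> T g (s r x) = s r (T g x)"
  using T_linear[of g] by (simp add: linear_on_sub_def)

lemma foldr_closed: "x \<in> A \<Longrightarrow> foldr T w x \<in> A"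
  by (induction w) (auto intro: T_closed)

lemma foldr_add: "\<lbrakk>x \<in> A; y \<in> A\<rbrakk> \<Longrightarrow> foldr T w (x + y) = foldr T w x + foldr T w y"
  by (induction w) (auto simp: T_add foldr_closed)

lemma foldr_scale: "x \<in> A \<Longrightarrow> foldr T w (s r x) = s r (foldr T w x)"
  by (induction w) (auto simp: T_scale foldr_closed)

lemma free_act_zero [simp]: "free_act s T 0 x = 0"
  by (simp add: free_act_def)

text \<open>The supports of \<open>p\<close>, \<open>q\<close> and \<open>p + q\<close> differ, but
  each summand is additive in its coefficient and vanishes with it, so all three sums can be taken
  over a common support.\<close>

lemma free_act_add: "free_act s T (p + q) x = free_act s T p x + free_act s T q x"
  unfolding free_act_def
  by (rule setsum_keys_plus_distrib) (simp_all add: scale_left_distrib)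

lemma free_act_single [simp]:
  "free_act s T (Poly_Mapping.single w r) x = s r (foldr T (letters w) x)"
  by (cases "r = 0") (simp_all add: free_act_def)

lemma free_act_minus: "free_act s T (- p) x = - free_act s T p x"
  using free_act_add[of "- p" p x] by (simp add: eq_neg_iff_add_eq_0)

lemma free_act_diff: "free_act s T (p - q) x = free_act s T p x - free_act s T q x"
  using free_act_add[of p "- q" x] by (simp add: free_act_minus)

lemma free_act_closed: "x \<in> A \<Longrightarrow> free_act s T p x \<in> A"
  unfolding free_act_def
  by (intro subspace_sum subspace_scale subspace_A foldr_closed)

lemma free_act_vector_add:
  "\<lbrakk>x \<in> A; y \<in> A\<rbrakk> \<Longrightarrow> free_act s T p (x + y) = free_act s T p x + free_act s T p y"
  by (simp add: free_act_def foldr_add scale_right_distrib sum.distrib)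

lemma free_act_vector_zero [simp]: "free_act s T p 0 = 0"
  using free_act_vector_add[of 0 0 p] subspace_A by (simp add: subspace_0)

text \<open>Both sides are additive in \<open>p\<close> and in \<open>q\<close>, so a double
  induction reduces to single words, where concatenation is composition of the operators. The vector
  must lie in \<open>A\<close>, since only there are the operators additive.\<close>

lemma free_act_mult:
  assumes x: "x \<in> A"
  shows "free_act s T (p * q) x = free_act s T p (free_act s T q x)"
proof (induction p rule: poly_mapping_add_single_induct)
  case (add_single p u a)
  have "free_act s T (Poly_Mapping.single u a * q) x
      = s a (foldr T (letters u) (free_act s T q x))"
  proof (induction q rule: poly_mapping_add_single_induct)
    case zero
    then show ?case
      using foldr_scale[of 0 "letters u" 0] subspace_A by (simp add: subspace_0)
  next
    case (add_single q w b)
    have "free_act s T q x \<in> A" "s b (foldr T (letters w) x) \<in> A"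
      using x by (auto intro: free_act_closed foldr_closed subspace_scale subspace_A)
    then show ?case
      using add_single x
      by (simp add: distrib_left free_act_add mult_single foldr_add foldr_scale foldr_closed
          scale_right_distrib)
  qed
  then show ?case
    using add_single by (simp add: distrib_right free_act_add)
qed simp

lemma free_act_free_gen [simp]: "free_act s T (free_gen g) x = T g x"
  by (simp add: free_gen_def)

lemma free_act_free_const [simp]: "free_act s T (free_const r) x = s r x"
  by (simp add: free_const_def)

lemma free_act_one [simp]: "free_act s T 1 x = x"
  by (simp flip: single_one)

lemma free_act_power: "x \<in> A \<Longrightarrow> free_act s T (free_gen g ^ n) x = (T g ^^ n) x"
proof (induction n arbitrary: x)
  case (Suc n)
  then show ?case
    by (simp add: free_act_mult)
qed simp

end

section \<open>From Taft relations and Leibniz rules of two operators to a module Lie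
  algebra\<close>

locale taft_operators = lie_algebra M + linear_operator_family "smul M" "carrier M" "case_taft_gen C V"
  for m :: nat and \<zeta> :: "'f::field"
    and M :: "('f, 'a::ab_group_add, 'x) taft_lie_struct_scheme"
    and C V :: "'a \<Rightarrow> 'a" +
  assumes act_M: "act M = gen_act (smul M) C V"
    and C_power: "x \<in> carrier M \<Longrightarrow> (C ^^ m) x = x"
    and V_power: "x \<in> carrier M \<Longrightarrow> (V ^^ m) x = 0"
    and V_C: "x \<in> carrier M \<Longrightarrow> V (C x) = smul M \<zeta> (C (V x))"
    and C_bracket: "\<lbrakk>x \<in> carrier M; y \<in> carrier M\<rbrakk> \<Longrightarrow> C (bracket M x y) = bracket M (C x) (C y)"
    and V_bracket: "\<lbrakk>x \<in> carrier M; y \<in> carrier M\<rbrakk> \<Longrightarrow>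
      V (bracket M x y) = bracket M (C x) (V y) + bracket M (V x) y"
begin

abbreviation "T \<equiv> case_taft_gen C V"
abbreviation "FA \<equiv> free_act (smul M) T"

lemma C_closed: "x \<in> carrier M \<Longrightarrow> C x \<in> carrier M"
  using T_closed[of x Gen_c] by simp

lemma V_closed: "x \<in> carrier M \<Longrightarrow> V x \<in> carrier M"
  using T_closed[of x Gen_v] by simp

text \<open>The elements that annihilate the carrier form a two-sided ideal containing the three
  defining relations, hence the whole ideal generated by them.\<close>

lemma free_act_taft_ideal:
  assumes "p \<in> taft_ideal m \<zeta>" "x \<in> carrier M"
  shows "FA p x = 0"
proof -
  let ?K = "{p. \<forall>x\<in>carrier M. FA p x = 0}"
  have "taft_ideal m \<zeta> \<subseteq> ?K"
    unfolding taft_ideal_def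
  proof (rule ring.genideal_minimal[OF ring_free_ring])
    show "ideal ?K free_ring"
      by (rule ideal_free_ringI) (auto simp: free_act_add free_act_mult free_act_closed)
    show "taft_relations m \<zeta> \<subseteq> ?K"
      by (auto simp: taft_relations_def free_act_diff free_act_mult free_act_power
          C_power V_power V_C)
  qed
  then show ?thesis
    using assms by blast
qed

lemma free_act_cong:
  assumes "q \<in> taft_class m \<zeta> p" "x \<in> carrier M"
  shows "FA q x = FA p x"
  using free_act_taft_ideal[OF taft_class_diff[OF assms(1)] assms(2)]
  by (simp add: free_act_diff)

text \<open>\<open>gen_act\<close> chooses some representative; \<open>taft_class_self\<close> shows
  that there is one, and \<open>free_act_cong\<close> makes the choice immaterial.\<close>

lemma act_taft_class: "x \<in> carrier M \<Longrightarrow> act M (taft_class m \<zeta> p) x = FA p x"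
  unfolding act_M gen_act_def
  by (rule free_act_cong) (rule someI, rule taft_class_self)

text \<open>The tensor square of the free algebra acting on a bracket: a pair of words
  \<open>(u, w)\<close> sends \<open>a\<close>, \<open>b\<close> to the bracket of
  \<open>u a\<close> and \<open>w b\<close>. At \<open>free_delta p\<close> this is the right-hand
  side of \<open>act_bracket\<close>.\<close>

definition tensor_act :: "(taft_word \<times> taft_word \<Rightarrow>\<^sub>0 'f) \<Rightarrow> 'a \<Rightarrow> 'a \<Rightarrow> 'a" where
  "tensor_act z a b = (\<Sum>k\<in>Poly_Mapping.keys z. smul M (Poly_Mapping.lookup z k)
     (bracket M (foldr T (letters (fst k)) a) (foldr T (letters (snd k)) b)))"

lemma tensor_act_zero [simp]: "tensor_act 0 a b = 0"
  by (simp add: tensor_act_def)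

lemma tensor_act_add: "tensor_act (y + z) a b = tensor_act y a b + tensor_act z a b"
  unfolding tensor_act_def
  by (rule setsum_keys_plus_distrib) (simp_all add: vs.scale_left_distrib)

lemma tensor_act_single [simp]:
  "tensor_act (Poly_Mapping.single k r) a b =
    smul M r (bracket M (foldr T (letters (fst k)) a) (foldr T (letters (snd k)) b))"
  by (cases "r = 0") (simp_all add: tensor_act_def)

lemma tensor_act_closed: "\<lbrakk>a \<in> carrier M; b \<in> carrier M\<rbrakk> \<Longrightarrow> tensor_act z a b \<in> carrier M"
  unfolding tensor_act_def
  by (intro sum_closed smul_closed bracket_closed foldr_closed)

lemma tensor_act_const_mult:
  "tensor_act (Poly_Mapping.single 0 r * z) a b = smul M r (tensor_act z a b)"
  by (induction z rule: poly_mapping_add_single_induct)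
    (simp_all add: distrib_left tensor_act_add mult_single vs.scale_right_distrib)

text \<open>At a single pair of words this is the Leibniz rule for \<open>C\<close> or
  \<open>V\<close>, applied to the bracket of the two images; additivity extends it to all
  \<open>z\<close>. Thus comultiplying a generator corresponds to applying it outside the
  bracket.\<close>

lemma tensor_act_delta_gen:
  assumes ab: "a \<in> carrier M" "b \<in> carrier M"
  shows "tensor_act (delta_gen g * z) a b = T g (tensor_act z a b)"
proof (induction z rule: poly_mapping_add_single_induct)
  case zero
  then show ?case
    \<comment> \<open>What remains is \<open>T g 0 = 0\<close>, read off from the action of
      \<open>free_gen g\<close>; the simp rule is removed so that it does not erase this
      fact.\<close>
    using free_act_vector_zero[of "free_gen g"] by (simp del: free_act_vector_zero)
next
  case (add_single z k r)
  have "tensor_act (delta_gen g * Poly_Mapping.single k r) a b =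
      T g (tensor_act (Poly_Mapping.single k r) a b)"
    using ab
    by (cases g; cases k)
      (simp_all add: mult_single distrib_right tensor_act_add
        T_scale[of _ Gen_c, simplified] T_scale[of _ Gen_v, simplified] C_bracket V_bracket
        foldr_closed bracket_closed vs.scale_right_distrib)
  then show ?case
    using add_single ab
    by (simp add: distrib_left tensor_act_add T_add tensor_act_closed smul_closed bracket_closed
        foldr_closed)
qed

lemma tensor_act_word:
  assumes ab: "a \<in> carrier M" "b \<in> carrier M"
  shows "tensor_act (prod_list (map delta_gen w)) a b = foldr T w (bracket M a b)"
proof (induction w)
  case Nil
  then show ?case
    by (simp flip: single_one)
qed (use ab in \<open>simp add: tensor_act_delta_gen\<close>)

lemma free_delta_add: "free_delta (p + q) = free_delta p + (free_delta q :: _ \<Rightarrow>\<^sub>0 'f)"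
  unfolding free_delta_def
  by (rule setsum_keys_plus_distrib) (simp_all add: single_add distrib_right)

lemma free_delta_single:
  "free_delta (Poly_Mapping.single w r) =
    Poly_Mapping.single 0 (r::'f) * prod_list (map delta_gen (letters w))"
  by (cases "r = 0") (simp_all add: free_delta_def)

text \<open>The Leibniz rule already in the free algebra, before passing to the quotient. By
  additivity only single words matter, and those are handled letter by letter in
  \<open>tensor_act_word\<close>.\<close>

lemma free_act_bracket:
  assumes ab: "a \<in> carrier M" "b \<in> carrier M"
  shows "FA p (bracket M a b) = tensor_act (free_delta p) a b"
proof (induction p rule: poly_mapping_add_single_induct)
  case zero
  then show ?case
    by (simp add: free_delta_def)
next
  case (add_single p w r)
  then show ?case
    using ab by (simp add: free_act_add free_delta_add tensor_act_add free_delta_single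
        tensor_act_const_mult tensor_act_word)
qed

theorem taft_module_lie_algebra: "taft_module_lie_algebra m \<zeta> M"
proof
  fix h p a b
  assume h: "h \<in> carrier (taft_algebra m \<zeta>)" "p \<in> h" and ab: "a \<in> carrier M" "b \<in> carrier M"
  obtain q where q: "h = taft_class m \<zeta> q"
    using h(1) by (auto simp: carrier_taft_algebra)
  \<comment> \<open>\<open>p\<close> and \<open>q\<close> may be different representatives of
    \<open>h\<close>. They act alike, so the Leibniz rule can be used for \<open>p\<close>.\<close>
  have "act M h (bracket M a b) = tensor_act (free_delta p) a b"
    using h(2) ab unfolding q by (simp add: act_taft_class bracket_closed
        flip: free_act_cong free_act_bracket)
  also have "\<dots> = (\<Sum>(u, w)\<in>Poly_Mapping.keys (free_delta p).
           smul M (Poly_Mapping.lookup (free_delta p) (u, w))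
             (bracket M (act M (taft_class m \<zeta> (Poly_Mapping.single u 1)) a)
                        (act M (taft_class m \<zeta> (Poly_Mapping.single w 1)) b)))"
    using ab unfolding tensor_act_def by (intro sum.cong) (auto simp: act_taft_class)
  finally show "act M h (bracket M a b) = \<dots>" .
qed (auto simp: carrier_taft_algebra taft_class_add taft_class_mult taft_class_one act_taft_class
    add_closed free_act_closed free_act_vector_add free_act_add free_act_mult)

end

section \<open>Transport of structure along a linear bijection\<close>

lemma linear_on_sub_sum:
  assumes "linear_on_sub s t V f" "vector_space s" "vector_space t" "module.subspace s V"
    and "\<And>i. i \<in> I \<Longrightarrow> g i \<in> V"
  shows "f (sum g I) = (\<Sum>i\<in>I. f (g i))"
proof -
  interpret s: vector_space s by fact
  interpret t: vector_space t by fact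
  have "f 0 = 0"
  proof -
    have "f (s 0 0) = t 0 (f 0)"
      using assms(1) s.subspace_0[OF assms(4)] unfolding linear_on_sub_def by blast
    then show ?thesis
      by simp
  qed
  \<comment> \<open>Additivity is known on \<open>V\<close> only, so the partial sums have to stay
    in \<open>V\<close>.\<close>
  moreover have "f (g i + sum g J) = f (g i) + f (sum g J)" if "i \<in> I" "J \<subseteq> I" for i J
    using assms(1,5) that s.subspace_sum[OF assms(4), of J g] unfolding linear_on_sub_def by blast
  moreover have "f (sum g J) = (\<Sum>i\<in>J. f (g i))" if "J \<subseteq> I" for J
    using that by (induction J rule: infinite_finite_induct) (simp_all add: calculation)
  ultimately show ?thesis
    by blast
qed

text \<open>Membership in \<open>A\<close> is part of the conclusion because the intertwining
  hypothesis is available only there.\<close>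

lemma foldr_intertwine:
  assumes "\<And>g x. x \<in> A \<Longrightarrow> T g x \<in> A" "\<And>g x. x \<in> A \<Longrightarrow> f (T g x) = U g (f x)"
    and "x \<in> A"
  shows "foldr T w x \<in> A \<and> f (foldr T w x) = foldr U w (f x)"
  using assms by (induction w) auto

text \<open>The Lie axioms and the Leibniz rules are checked on \<open>N\<close>, the relations of the
  Taft algebra on \<open>M\<close>; the bijection moves each to the other side.\<close>

lemma taft_lie_isomorphicI:
  fixes M :: "('f::field, 'a::ab_group_add) taft_lie_struct"
    and N :: "('f, 'b::ab_group_add) taft_lie_struct"
  assumes N: "lie_algebra N"
    and vs_M: "vector_space (smul M)" and sub_M: "module.subspace (smul M) (carrier M)"
    and br_M: "\<And>x y. \<lbrakk>x \<in> carrier M; y \<in> carrier M\<rbrakk> \<Longrightarrow> bracket M x y \<in> carrier M"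
    and bij: "bij_betw f (carrier M) (carrier N)"
    and lin: "linear_on_sub (smul M) (smul N) (carrier M) f"
    and f_br: "\<And>x y. \<lbrakk>x \<in> carrier M; y \<in> carrier M\<rbrakk> \<Longrightarrow>
      f (bracket M x y) = bracket N (f x) (f y)"
    and T_closed: "\<And>g x. x \<in> carrier M \<Longrightarrow> case_taft_gen C V g x \<in> carrier M"
    and T_linear: "\<And>g. linear_on_sub (smul M) (smul M) (carrier M) (case_taft_gen C V g)"
    and T_f: "\<And>g x. x \<in> carrier M \<Longrightarrow> f (case_taft_gen C V g x) = case_taft_gen C' V' g (f x)"
    and act_M: "act M = gen_act (smul M) C V" and act_N: "act N = gen_act (smul N) C' V'"
    and C_power: "\<And>x. x \<in> carrier M \<Longrightarrow> (C ^^ m) x = x"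
    and V_power: "\<And>x. x \<in> carrier M \<Longrightarrow> (V ^^ m) x = 0"
    and V_C: "\<And>x. x \<in> carrier M \<Longrightarrow> V (C x) = smul M \<zeta> (C (V x))"
    and C_br: "\<And>x y. \<lbrakk>x \<in> carrier N; y \<in> carrier N\<rbrakk> \<Longrightarrow>
      C' (bracket N x y) = bracket N (C' x) (C' y)"
    and V_br: "\<And>x y. \<lbrakk>x \<in> carrier N; y \<in> carrier N\<rbrakk> \<Longrightarrow>
      V' (bracket N x y) = bracket N (C' x) (V' y) + bracket N (V' x) y"
  shows "taft_lie_isomorphic m \<zeta> M N"
proof -
  interpret N: lie_algebra N by fact
  interpret vs_M: vector_space "smul M" by fact
  have f_closed: "f x \<in> carrier N" if "x \<in> carrier M" for x
    using bij that by (auto simp: bij_betw_def)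
  have f_add: "f (x + y) = f x + f y" if "x \<in> carrier M" "y \<in> carrier M" for x y
    using lin that by (simp add: linear_on_sub_def)
  have f_smul: "f (smul M r x) = smul N r (f x)" if "x \<in> carrier M" for r x
    using lin that by (simp add: linear_on_sub_def)
  have f_eqI: "x = y" if "f x = f y" "x \<in> carrier M" "y \<in> carrier M" for x y
    using bij that by (auto simp: bij_betw_def inj_on_def)
  have f_surj: "\<exists>x\<in>carrier M. y = f x" if "y \<in> carrier N" for y
    using bij that by (auto simp: bij_betw_def)
  note add_M = vs_M.subspace_add[OF sub_M] and smul_M = vs_M.subspace_scale[OF sub_M]
  have zero_M: "0 \<in> carrier M"
    using sub_M by (rule vs_M.subspace_0)
  have f_zero: "f 0 = 0"
    using f_smul[OF zero_M, of 0] by simp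
  interpret M: lie_algebra M
  proof
    fix x y z r
    assume x: "x \<in> carrier M"
    show "bracket M x x = 0"
      by (rule f_eqI) (simp_all add: x f_br f_zero f_closed zero_M br_M N.bracket_self)
    assume y: "y \<in> carrier M"
    show "bracket M x y \<in> carrier M"
      using x y by (rule br_M)
    show "bracket M (smul M r x) y = smul M r (bracket M x y)"
      by (rule f_eqI) (simp_all add: x y f_br f_smul f_closed smul_M br_M N.bracket_smul_left)
    show "bracket M x (smul M r y) = smul M r (bracket M x y)"
      by (rule f_eqI) (simp_all add: x y f_br f_smul f_closed smul_M br_M N.bracket_smul_right)
    assume z: "z \<in> carrier M"
    show "bracket M (x + y) z = bracket M x z + bracket M y z"
      by (rule f_eqI) (simp_all add: x y z f_br f_add f_closed add_M br_M N.bracket_add_left)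
    show "bracket M x (y + z) = bracket M x y + bracket M x z"
      by (rule f_eqI) (simp_all add: x y z f_br f_add f_closed add_M br_M N.bracket_add_right)
    show "bracket M x (bracket M y z) + bracket M y (bracket M z x) + bracket M z (bracket M x y) = 0"
      by (rule f_eqI)
        (simp_all add: x y z f_br f_add f_zero f_closed zero_M add_M br_M N.jacobi)
  qed (fact vs_M sub_M)+
  have C_f: "f (C x) = C' (f x)" and V_f: "f (V x) = V' (f x)" and C_closed: "C x \<in> carrier M"
    and V_closed: "V x \<in> carrier M" if "x \<in> carrier M" for x
    using T_f[OF that, of Gen_c] T_f[OF that, of Gen_v] T_closed[OF that, of Gen_c]
      T_closed[OF that, of Gen_v] by simp_all
  have T_add: "case_taft_gen C V g (x + y) = case_taft_gen C V g x + case_taft_gen C V g y"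
    if "x \<in> carrier M" "y \<in> carrier M" for g x y
    using T_linear[of g] that by (simp add: linear_on_sub_def)
  have T_smul: "case_taft_gen C V g (smul M r x) = smul M r (case_taft_gen C V g x)"
    if "x \<in> carrier M" for g r x
    using T_linear[of g] that by (simp add: linear_on_sub_def)
  have C_pow: "(C ^^ n) x \<in> carrier M \<and> f ((C ^^ n) x) = (C' ^^ n) (f x)"
    and V_pow: "(V ^^ n) x \<in> carrier M \<and> f ((V ^^ n) x) = (V' ^^ n) (f x)"
    if "x \<in> carrier M" for n x
    using that by (induction n) (auto simp: C_f C_closed V_f V_closed)
  interpret M: taft_operators m \<zeta> M C V
  proof
    fix x y assume x: "x \<in> carrier M" and y: "y \<in> carrier M"
    show "C (bracket M x y) = bracket M (C x) (C y)"
      by (rule f_eqI) (simp_all add: x y f_br C_f C_br f_closed br_M C_closed)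
    show "V (bracket M x y) = bracket M (C x) (V y) + bracket M (V x) y"
      by (rule f_eqI)
        (simp_all add: x y f_br f_add C_f V_f V_br f_closed br_M add_M C_closed V_closed)
  qed (fact act_M C_power V_power V_C T_closed T_linear sub_M | erule T_closed C_power V_power V_C)+
  interpret N: taft_operators m \<zeta> N C' V'
  proof
    fix y assume "y \<in> carrier N"
    then obtain x where x: "x \<in> carrier M" "y = f x"
      using f_surj by blast
    show "case_taft_gen C' V' g y \<in> carrier N" for g
      using x f_closed[OF T_closed[OF x(1), of g]] by (simp add: T_f)
    show "(C' ^^ m) y = y"
      using C_pow[OF x(1), of m] C_power[OF x(1)] x(2) by simp
    show "(V' ^^ m) y = 0"
      using V_pow[OF x(1), of m] V_power[OF x(1)] x(2) by (simp add: f_zero)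
    show "V' (C' y) = smul N \<zeta> (C' (V' y))"
      using arg_cong[OF V_C[OF x(1)], of f] x
      by (simp add: f_smul C_f V_f C_closed V_closed)
  next
    show "linear_on_sub (smul N) (smul N) (carrier N) (case_taft_gen C' V' g)" for g
      unfolding linear_on_sub_def
    proof (intro conjI ballI allI)
      fix y z r assume "y \<in> carrier N" "z \<in> carrier N"
      then obtain x w where x: "x \<in> carrier M" "y = f x" and w: "w \<in> carrier M" "z = f w"
        using f_surj by meson
      show "case_taft_gen C' V' g (y + z) = case_taft_gen C' V' g y + case_taft_gen C' V' g z"
        using arg_cong[OF T_add[OF x(1) w(1), of g], of f] x w
        by (simp add: T_f f_add T_closed add_M)
      show "case_taft_gen C' V' g (smul N r y) = smul N r (case_taft_gen C' V' g y)"
        using arg_cong[OF T_smul[OF x(1), of g r], of f] x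
        by (simp add: T_f f_smul T_closed smul_M)
    qed
  qed (fact act_N C_br V_br N.subspace | erule C_br V_br, assumption)+
  \<comment> \<open>\<open>gen_act\<close> picks the same representative of \<open>h\<close> on both
    sides, so it suffices that \<open>f\<close> intertwines the actions of one fixed element of the
    free algebra.\<close>
  have "f (act M h x) = act N h (f x)" if "x \<in> carrier M" for h x
  proof -
    have "f (free_act (smul M) (case_taft_gen C V) p x)
        = free_act (smul N) (case_taft_gen C' V') p (f x)" for p
    proof -
      have *: "foldr (case_taft_gen C V) w x \<in> carrier M \<and>
          f (foldr (case_taft_gen C V) w x) = foldr (case_taft_gen C' V') w (f x)" for w
        using T_closed T_f that by (rule foldr_intertwine)
      show ?thesis
        unfolding free_act_def
        by (subst linear_on_sub_sum[OF lin vs_M N.vector_space sub_M])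
          (simp_all add: * smul_M f_smul)
    qed
    then show ?thesis
      by (simp add: act_M act_N gen_act_def)
  qed
  then have "taft_lie_iso m \<zeta> M N f"
    using bij lin f_br by (simp add: taft_lie_iso_def)
  then show ?thesis
    using M.taft_module_lie_algebra N.taft_module_lie_algebra
    by (auto simp: taft_lie_isomorphic_def)
qed

section \<open>Primitive roots of unity\<close>

text \<open>If \<open>m\<close> were zero in the field, the polynomial
  \<open>1 + X + ... + X^(m-1)\<close> would vanish at \<open>1\<close> as well as at all other
  powers of \<zeta>. That makes \<open>m\<close> distinct roots in degree at most
  \<open>m - 1\<close>.\<close>

lemma primitive_root_of_unity_of_nat_neq_0:
  assumes "primitive_root_of_unity m (\<zeta>::'f::field)" "m > 0"
  shows "of_nat m \<noteq> (0::'f)"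
proof
  assume m: "of_nat m = (0::'f)"
  define p :: "'f poly" where "p = (\<Sum>k<m. monom 1 k)"
  have poly_p: "poly p x = (\<Sum>k<m. x ^ k)" for x
    by (simp add: p_def poly_sum poly_monom)
  have "coeff p 0 = 1"
    using assms(2) by (simp add: p_def coeff_sum coeff_monom if_distrib sum.delta cong: if_cong)
  then have "p \<noteq> 0"
    by auto
  have deg: "Polynomial.degree p \<le> m - 1"
    unfolding p_def by (rule degree_sum_le) (auto intro: order_trans[OF degree_monom_le])
  have inj: "inj_on (\<lambda>i. \<zeta> ^ i) {..<m}"
  proof (rule linorder_inj_onI)
    fix i j assume ij: "i < j" "i \<in> {..<m}" "j \<in> {..<m}"
    have "\<zeta> \<noteq> 0"
      using assms by (auto simp: primitive_root_of_unity_def power_0_left)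
    moreover have "\<zeta> ^ (j - i) \<noteq> 1"
      using assms ij by (simp add: primitive_root_of_unity_def)
    ultimately show "\<zeta> ^ i \<noteq> \<zeta> ^ j"
      using ij by (simp add: power_diff)
  qed auto
  have "(\<lambda>i. \<zeta> ^ i) ` {..<m} \<subseteq> {x. poly p x = 0}"
  proof safe
    fix i assume i: "i < m"
    have pow: "(\<zeta> ^ i) ^ m = 1"
      using assms by (metis primitive_root_of_unity_def power_mult mult.commute power_one)
    show "poly p (\<zeta> ^ i) = 0"
    proof (cases "\<zeta> ^ i = 1")
      case True
      then show ?thesis
        using m by (simp add: poly_p)
    next
      case False
      then show ?thesis
        using pow by (simp add: poly_p geometric_sum)
    qed
  qed
  then have "card ((\<lambda>i. \<zeta> ^ i) ` {..<m}) \<le> card {x. poly p x = 0}"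
    by (intro card_mono poly_roots_finite \<open>p \<noteq> 0\<close>)
  also have "\<dots> \<le> m - 1"
    using card_poly_roots_bound[OF \<open>p \<noteq> 0\<close>] deg by linarith
  finally show False
    using inj assms(2) by (simp add: card_image)
qed

section \<open>Quantum numbers and factorials\<close>

lemma one_minus_times_qnum: "(1 - \<zeta>) * qnum \<zeta> n = 1 - \<zeta> ^ n"
  by (simp add: qnum_def one_diff_power_eq)

lemma qfact_0 [simp]: "qfact \<zeta> 0 = 1"
  by (simp add: qfact_def)

lemma qfact_Suc [simp]: "qfact \<zeta> (Suc n) = qfact \<zeta> n * qnum \<zeta> (Suc n)"
  by (simp add: qfact_def mult.commute)

text \<open>The separately defined boundary values agree with the quotient formula once the
  factorial is nonzero.\<close>

lemma qbinom_eq: "k \<le> n \<Longrightarrow> qfact \<zeta> n \<noteq> 0 \<Longrightarrow>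
    qbinom \<zeta> n k = qfact \<zeta> n / (qfact \<zeta> (n - k) * qfact \<zeta> k)"
  by (auto simp: qbinom_def)

section \<open>Scalars attached to a primitive root of unity\<close>

locale root_of_unity_data =
  fixes m :: nat and \<zeta> \<alpha> :: "'f::field"
  assumes m_ge_2: "m \<ge> 2" and root: "primitive_root_of_unity m \<zeta>" and \<alpha>_neq_0: "\<alpha> \<noteq> 0"
begin

lemma m_pos: "m > 0"
  using m_ge_2 by simp

lemma \<zeta>_power_m [simp]: "\<zeta> ^ m = 1"
  using root by (simp add: primitive_root_of_unity_def)

lemma \<zeta>_power_neq_1: "0 < k \<Longrightarrow> k < m \<Longrightarrow> \<zeta> ^ k \<noteq> 1"
  using root by (simp add: primitive_root_of_unity_def)

lemma \<zeta>_neq_0 [simp]: "\<zeta> \<noteq> 0"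
  using \<zeta>_power_m m_pos by (metis power_eq_0_iff zero_neq_one)

lemma \<zeta>_neq_1: "1 - \<zeta> \<noteq> 0"
  using \<zeta>_power_neq_1[of 1] m_ge_2 by simp

lemma of_nat_m_neq_0: "of_nat m \<noteq> (0::'f)"
  using root m_pos by (rule primitive_root_of_unity_of_nat_neq_0)

lemma qnum_neq_0: "0 < k \<Longrightarrow> k < m \<Longrightarrow> qnum \<zeta> k \<noteq> 0"
  using one_minus_times_qnum[of \<zeta> k] \<zeta>_power_neq_1[of k] by auto

lemma qfact_neq_0: "k < m \<Longrightarrow> qfact \<zeta> k \<noteq> 0"
  by (induction k) (simp_all add: qnum_neq_0)

text \<open>With this constant the factor \<open>\<alpha> * (1 - \<zeta> ^ k)\<close>, by which
  \<open>v\<close> lowers the \<open>k\<close>th eigenvector of \<open>c\<close>, equals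
  \<open>\<beta> * qnum \<zeta> k\<close>, and the parameter in the theorem is
  \<open>1 / \<beta> ^ m\<close>.\<close>

definition \<beta> :: 'f where "\<beta> = \<alpha> * (1 - \<zeta>)"

lemma \<beta>_neq_0: "\<beta> \<noteq> 0"
  using \<alpha>_neq_0 \<zeta>_neq_1 by (simp add: \<beta>_def)

text \<open>The isomorphism sends \<open>\<phi>\<^sup>k(a)\<close> to the multiple of the \<open>\<zeta>\<^sup>k\<close>-eigenvector
  \<open>(\<zeta>\<^bsup>-ik\<^esup> a)\<^sub>i\<close> of \<open>c\<close> that is compatible with \<open>v\<close>.\<close>

definition \<epsilon> :: "nat \<Rightarrow> nat \<Rightarrow> 'f" where
  "\<epsilon> i k = 1 / (\<zeta> ^ (i * k) * (\<beta> ^ k * qfact \<zeta> k))"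

text \<open>The powers of \<zeta> and \<beta> are multiplicative in \<open>k\<close>; comparing the
  remaining factorials leaves the quantum binomial.\<close>

lemma \<epsilon>_mult_less:
  assumes "k + l < m"
  shows "\<epsilon> i k * \<epsilon> i l = qbinom \<zeta> (k + l) k * \<epsilon> i (k + l)"
  using assms qfact_neq_0[of "k + l"] qfact_neq_0[of k] qfact_neq_0[of l]
  by (simp add: \<epsilon>_def qbinom_eq power_add distrib_left)

text \<open>Write \<open>k + l = m + n\<close>. The surplus \<open>\<zeta> ^ (i * m)\<close> is
  \<open>1\<close>, while the surplus \<open>\<beta> ^ m\<close> survives and produces the parameter
  of the bracket. As \<open>n < m\<close>, the factorial of \<open>n\<close> can be
  cancelled.\<close>

lemma \<epsilon>_mult_ge:
  assumes "k < m" "l < m" "k + l \<ge> m"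
  shows "\<epsilon> i k * \<epsilon> i l
    = 1 / (\<alpha> ^ m * (1 - \<zeta>) ^ m) * (qfact \<zeta> (k + l - m) / (qfact \<zeta> k * qfact \<zeta> l)) * \<epsilon> i (k + l - m)"
proof -
  obtain n where n: "k + l = m + n"
    using assms(3) by (metis le_Suc_ex)
  have nm: "qfact \<zeta> n \<noteq> 0"
    using assms n by (intro qfact_neq_0) simp
  have "\<epsilon> i k * \<epsilon> i l = 1 / (\<zeta> ^ (i * (k + l)) * (\<beta> ^ (k + l) * (qfact \<zeta> k * qfact \<zeta> l)))"
    by (simp add: \<epsilon>_def power_add distrib_left)
  also have "\<zeta> ^ (i * (k + l)) = \<zeta> ^ (i * n)"
    by (simp add: n distrib_left power_add mult.commute[of i m] power_mult[of _ m])
  also have "\<beta> ^ (k + l) = \<alpha> ^ m * (1 - \<zeta>) ^ m * \<beta> ^ n"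
    by (simp add: n power_add \<beta>_def power_mult_distrib)
  finally show ?thesis
    using nm by (simp add: n \<epsilon>_def mult_ac)
qed

lemma \<epsilon>_Suc_left: "\<epsilon> (Suc i) k * \<zeta> ^ k = \<epsilon> i k"
  by (simp add: \<epsilon>_def power_add)

text \<open>The scalars are periodic in \<open>i\<close> with period \<open>m\<close>; this handles
  the wrap-around of \<open>c\<close> at position \<open>0\<close>.\<close>

lemma \<epsilon>_cyclic: "\<epsilon> 0 k * \<zeta> ^ k = \<epsilon> (m - 1) k"
proof -
  have "\<epsilon> (Suc (m - 1)) k = \<epsilon> 0 k"
    by (simp add: m_pos \<epsilon>_def power_mult)
  then show ?thesis
    using \<epsilon>_Suc_left[of "m - 1" k] by simp
qed

text \<open>The recursion behind compatibility with \<open>v\<close>: the factor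
  \<open>1 - \<zeta> ^ Suc k\<close> cancels the quantum number by which consecutive factorials
  differ.\<close>

lemma \<epsilon>_Suc_right:
  assumes "Suc k < m"
  shows "\<alpha> * (\<zeta> ^ i * (\<epsilon> i (Suc k) - \<epsilon> i (Suc k) * \<zeta> ^ Suc k)) = \<epsilon> i k"
proof -
  have "\<epsilon> i (Suc k) - \<epsilon> i (Suc k) * \<zeta> ^ Suc k = \<epsilon> i (Suc k) * ((1 - \<zeta>) * qnum \<zeta> (Suc k))"
    by (simp only: one_minus_times_qnum right_diff_distrib mult_1_right)
  moreover have "qnum \<zeta> (Suc k) \<noteq> 0" "qfact \<zeta> k \<noteq> 0"
    using assms by (simp_all add: qnum_neq_0 qfact_neq_0)
  moreover have "\<epsilon> i (Suc k) = \<epsilon> i k / (\<zeta> ^ i * (\<alpha> * ((1 - \<zeta>) * qnum \<zeta> (Suc k))))"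
    by (simp add: \<epsilon>_def \<beta>_def power_add)
  ultimately show ?thesis
    using \<alpha>_neq_0 \<zeta>_neq_1 by (simp only:) simp
qed

text \<open>A geometric sum whose ratio \<open>\<zeta> ^ i / \<zeta> ^ j\<close> is an
  \<open>m\<close>th root of unity, equal to \<open>1\<close> only for \<open>i = j\<close>.\<close>

lemma character_orthogonality:
  assumes "i < m" "j < m"
  shows "(\<Sum>k<m. \<zeta> ^ (k * i) / \<zeta> ^ (k * j)) = (if i = j then of_nat m else 0)"
proof -
  have "(\<Sum>k<m. \<zeta> ^ (k * i) / \<zeta> ^ (k * j)) = (\<Sum>k<m. (\<zeta> ^ i / \<zeta> ^ j) ^ k)"
    by (simp add: power_divide power_mult[symmetric] mult.commute)
  also have "\<dots> = (if i = j then of_nat m else 0)"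
  proof (cases "i = j")
    case False
    have *: "\<zeta> ^ i \<noteq> \<zeta> ^ j" if "i < j" "j < m" for i j
      using \<zeta>_power_neq_1[of "j - i"] that by (auto simp: power_diff less_imp_diff_less)
    have "\<zeta> ^ i / \<zeta> ^ j \<noteq> 1"
      using *[of i j] *[of j i] assms False by (cases i j rule: linorder_cases) auto
    moreover have "(\<zeta> ^ i / \<zeta> ^ j) ^ m = 1"
      by (simp add: power_divide power_mult[symmetric] mult.commute[of _ m]) (simp add: power_mult)
    ultimately show ?thesis
      using False by (simp add: geometric_sum)
  qed simp
  finally show ?thesis .
qed

end

section \<open>The isomorphism\<close>

lemma sum_apply: "sum g A i = (\<Sum>k\<in>A. g k i)"
  for g :: "'c \<Rightarrow> 'a \<Rightarrow> 'b::comm_monoid_add"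
  by (induction A rule: infinite_finite_induct) auto

lemma vector_space_dsum_smul:
  assumes "vector_space s"
  shows "vector_space (dsum_smul s)"
proof -
  interpret vector_space s by fact
  show ?thesis
    by standard
      (auto simp: dsum_smul_def fun_eq_iff scale_right_distrib scale_left_distrib)
qed

lemma subspace_dsum:
  assumes "vector_space s" "\<And>i. i < m \<Longrightarrow> module.subspace s (A i)"
  shows "module.subspace (dsum_smul s) (dsum m A)"
proof -
  interpret vector_space s by fact
  interpret d: vector_space "dsum_smul s" using assms(1) by (rule vector_space_dsum_smul)
  show ?thesis
    using assms(2) unfolding d.subspace_def
    by (auto simp: dsum_def dsum_smul_def subspace_0 subspace_add subspace_scale)
qed

section \<open>Powers of \<phi> and coordinates on the graded side\<close>

locale L_alpha_L_gamma = root_of_unity_data m \<zeta> \<alpha> + lie_algebra B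
  for m :: nat and \<zeta> \<alpha> :: "'f::field" and B :: "('f, 'b::ab_group_add) lie_struct" +
  fixes W :: "nat \<Rightarrow> 'b set" and \<phi> :: "nat \<Rightarrow> 'b \<Rightarrow> 'b"
  assumes phi: "phi_data m B W \<phi>"
begin

abbreviation "s \<equiv> smul B"
abbreviation "coord \<equiv> phi_coord m B \<phi>"
abbreviation "M \<equiv> L_gamma m \<zeta> (1 / (\<alpha> ^ m * (1 - \<zeta>) ^ m)) B W \<phi>"
abbreviation "N \<equiv> L_alpha m \<zeta> \<alpha> B"

lemma W_0: "W 0 = carrier B"
  using phi by (simp add: phi_data_def)

lemma subspace_W: "i < m \<Longrightarrow> vs.subspace (W i)"
  using phi by (simp add: phi_data_def)

lemma phi_bij: "Suc i < m \<Longrightarrow> bij_betw (\<phi> (Suc i)) (W i) (W (Suc i))"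
  and phi_linear: "Suc i < m \<Longrightarrow> linear_on_sub s s (W i) (\<phi> (Suc i))"
  using phi unfolding phi_data_def by (metis One_nat_def diff_Suc_1 le_add1 plus_1_eq_Suc)+

lemma phi_zero [simp]: "Suc i < m \<Longrightarrow> \<phi> (Suc i) 0 = 0"
  using linear_on_sub_sum[OF phi_linear vector_space vector_space subspace_W, of i "{}"] by simp

text \<open>The composite of the first \<open>k\<close> bijections, from \<open>B\<close> to
  \<open>W k\<close>: the \<open>k\<close>th power of \<phi> without the embedding into the direct
  sum.\<close>

primrec \<psi> :: "nat \<Rightarrow> 'b \<Rightarrow> 'b" where
  "\<psi> 0 a = a"
| "\<psi> (Suc k) a = \<phi> (Suc k) (\<psi> k a)"

lemma \<psi>_bij: "k < m \<Longrightarrow> bij_betw (\<psi> k) (carrier B) (W k)"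
proof (induction k)
  case 0
  then show ?case
    by (auto simp: W_0 bij_betw_def inj_on_def)
next
  case (Suc k)
  have "bij_betw (\<phi> (Suc k) \<circ> \<psi> k) (carrier B) (W (Suc k))"
    using Suc phi_bij by (intro bij_betw_trans[of "\<psi> k" _ "W k"]) auto
  then show ?case
    by (simp add: comp_def)
qed

lemma \<psi>_closed: "k < m \<Longrightarrow> a \<in> carrier B \<Longrightarrow> \<psi> k a \<in> W k"
  using \<psi>_bij by (auto simp: bij_betw_def)

lemma \<psi>_linear: "k < m \<Longrightarrow> linear_on_sub s s (carrier B) (\<psi> k)"
proof (induction k)
  case (Suc k)
  then show ?case
    using phi_linear[of k] \<psi>_closed[of k] by (auto simp: linear_on_sub_def)
qed (simp add: linear_on_sub_def)

text \<open>Each application of \<open>Phi\<close> moves the only nonzero component up by one place;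
  \<open>k < m\<close> keeps it from falling off the end.\<close>

lemma phi_pow_eq: "k < m \<Longrightarrow> phi_pow m \<phi> k a = (\<lambda>i. if i = k then \<psi> k a else 0)"
proof (induction k)
  case 0
  then show ?case
    by (auto simp: phi_pow_def emb0_def)
next
  case (Suc k)
  have "phi_pow m \<phi> (Suc k) a = Phi m \<phi> (\<lambda>i. if i = k then \<psi> k a else 0)"
    using Suc by (simp add: phi_pow_def)
  also have "\<dots> = (\<lambda>i. if i = Suc k then \<psi> (Suc k) a else 0)"
  proof
    fix i
    show "Phi m \<phi> (\<lambda>i. if i = k then \<psi> k a else 0) i = (if i = Suc k then \<psi> (Suc k) a else 0)"
      using Suc.prems by (cases i) (auto simp: Phi_def)
  qed
  finally show ?case .
qed

lemma phi_coord_eq: "k < m \<Longrightarrow> coord k x = inv_into (carrier B) (\<psi> k) (x k)"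
  by (simp add: phi_coord_def phi_pow_eq)

text \<open>By injectivity of \<open>\<psi> k\<close>, a coordinate is identified by exhibiting a
  preimage; the coordinate computations below go this way.\<close>

lemma coord_eqI: "k < m \<Longrightarrow> a \<in> carrier B \<Longrightarrow> x k = \<psi> k a \<Longrightarrow> coord k x = a"
  using \<psi>_bij[of k] by (simp add: phi_coord_eq bij_betw_def)

abbreviation "D \<equiv> dsum m W"

lemma \<psi>_coord: "x \<in> D \<Longrightarrow> k < m \<Longrightarrow> \<psi> k (coord k x) = x k"
  using \<psi>_bij[of k] by (auto simp: phi_coord_eq bij_betw_def dsum_def intro: f_inv_into_f)

lemma coord_closed: "x \<in> D \<Longrightarrow> k < m \<Longrightarrow> coord k x \<in> carrier B"
  using \<psi>_bij[of k] by (auto simp: phi_coord_eq bij_betw_def dsum_def intro!: inv_into_into)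

lemma D_eqI:
  assumes "x \<in> D" "y \<in> D" "\<And>k. k < m \<Longrightarrow> coord k x = coord k y"
  shows "x = y"
proof
  fix k
  show "x k = y k"
    using \<psi>_coord[OF assms(1), of k] \<psi>_coord[OF assms(2), of k] assms
    by (cases "k < m") (auto simp: dsum_def)
qed

lemma vs_D: "vector_space (dsum_smul s)"
  using vector_space by (rule vector_space_dsum_smul)

lemma subspace_D: "module.subspace (dsum_smul s) D"
  by (rule subspace_dsum[OF vector_space subspace_W])

sublocale dv: vector_space "dsum_smul s"
  by (rule vs_D)

lemma coord_add: "\<lbrakk>x \<in> D; y \<in> D; k < m\<rbrakk> \<Longrightarrow> coord k (x + y) = coord k x + coord k y"
  using \<psi>_linear[of k]
  by (intro coord_eqI) (auto simp: linear_on_sub_def add_closed coord_closed \<psi>_coord)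

lemma coord_smul: "\<lbrakk>x \<in> D; k < m\<rbrakk> \<Longrightarrow> coord k (dsum_smul s r x) = s r (coord k x)"
  using \<psi>_linear[of k]
  by (intro coord_eqI) (auto simp: linear_on_sub_def smul_closed coord_closed \<psi>_coord dsum_smul_def)

lemma phi_pow_closed: "k < m \<Longrightarrow> a \<in> carrier B \<Longrightarrow> phi_pow m \<phi> k a \<in> D"
  by (auto simp: phi_pow_eq dsum_def \<psi>_closed vs.subspace_0[OF subspace_W])

lemma \<psi>_zero [simp]: "k < m \<Longrightarrow> \<psi> k 0 = 0"
  by (induction k) auto

lemma coord_phi_pow:
  "\<lbrakk>k < m; n < m; a \<in> carrier B\<rbrakk> \<Longrightarrow> coord k (phi_pow m \<phi> n a) = (if k = n then a else 0)"
  by (rule coord_eqI) (auto simp: phi_pow_eq zero_closed)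

lemma L_gamma_c_closed: "x \<in> D \<Longrightarrow> L_gamma_c m \<zeta> s x \<in> D"
  by (auto simp: L_gamma_c_def dsum_def vs.subspace_scale[OF subspace_W])

lemma L_gamma_v_closed: "x \<in> D \<Longrightarrow> L_gamma_v m W \<phi> x \<in> D"
  using phi_bij by (auto simp: L_gamma_v_def dsum_def bij_betw_def intro!: inv_into_into
      vs.subspace_0[OF subspace_W])

lemma coord_L_gamma_c: "\<lbrakk>x \<in> D; k < m\<rbrakk> \<Longrightarrow> coord k (L_gamma_c m \<zeta> s x) = s (\<zeta> ^ k) (coord k x)"
  using \<psi>_linear[of k]
  by (intro coord_eqI) (auto simp: linear_on_sub_def smul_closed coord_closed \<psi>_coord L_gamma_c_def)

text \<open>Component \<open>Suc k\<close> is \<phi> applied to \<open>\<psi> k\<close> of its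
  coordinate, so inverting \<phi> leaves that coordinate one degree lower. Nothing comes down into
  the top degree \<open>m - 1\<close>.\<close>

lemma coord_L_gamma_v:
  assumes "x \<in> D" "k < m"
  shows "coord k (L_gamma_v m W \<phi> x) = (if Suc k < m then coord (Suc k) x else 0)"
proof (rule coord_eqI)
  show "L_gamma_v m W \<phi> x k = \<psi> k (if Suc k < m then coord (Suc k) x else 0)"
  proof (cases "Suc k < m")
    case True
    have "x (Suc k) = \<phi> (Suc k) (\<psi> k (coord (Suc k) x))"
      using \<psi>_coord[OF assms(1) True] by simp
    then show ?thesis
      using True phi_bij[OF True] assms
      by (simp add: L_gamma_v_def bij_betw_def inv_into_f_f \<psi>_closed coord_closed)
  qed (use assms in \<open>simp add: L_gamma_v_def\<close>)
qed (use assms in \<open>auto simp: zero_closed coord_closed\<close>)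

lemma L_gamma_bracket_term_closed:
  assumes "k < m" "l < m" "a \<in> carrier B"
  shows "(if k + l < m then dsum_smul s r (phi_pow m \<phi> (k + l) a)
     else dsum_smul s t (phi_pow m \<phi> (k + l - m) a)) \<in> D"
  using assms by (auto intro!: dv.subspace_scale subspace_D phi_pow_closed)

text \<open>A weighted discrete Fourier transform of the coordinates, sending the \<open>k\<close>th
  power of \<phi> at \<open>a\<close> to the sequence with entries \<open>\<epsilon> i k\<close>
  times \<open>a\<close>.\<close>

definition F :: "(nat \<Rightarrow> 'b) \<Rightarrow> nat \<Rightarrow> 'b" where
  "F x = (\<lambda>i. if i < m then \<Sum>k<m. s (\<epsilon> i k) (coord k x) else 0)"

section \<open>Linearity and bijectivity of the weighted Fourier transform\<close>

abbreviation "E \<equiv> dsum m (\<lambda>i. carrier B)"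

lemma F_linear: "linear_on_sub (dsum_smul s) (dsum_smul s) D F"
  unfolding linear_on_sub_def
proof (intro conjI ballI allI)
  show "F (x + y) = F x + F y" if "x \<in> D" "y \<in> D" for x y
    using that
    by (auto simp: F_def fun_eq_iff coord_add vs.scale_right_distrib sum.distrib)
  show "F (dsum_smul s r x) = dsum_smul s r (F x)" if "x \<in> D" for x r
  proof
    fix i
    have "F (dsum_smul s r x) i = s r (F x i)"
      using that by (simp add: F_def coord_smul vs.scale_sum_right mult.commute)
    then show "F (dsum_smul s r x) i = dsum_smul s r (F x) i"
      by (simp add: dsum_smul_def)
  qed
qed

lemma F_phi_pow:
  assumes "n < m" "a \<in> carrier B" "i < m"
  shows "F (phi_pow m \<phi> n a) i = s (\<epsilon> i n) a"
  using assms by (simp add: F_def coord_phi_pow if_distrib[of "s _"] cong: if_cong)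

lemma F_closed: "x \<in> D \<Longrightarrow> F x \<in> E"
  by (auto simp: F_def dsum_def intro!: sum_closed smul_closed coord_closed)

text \<open>Fourier inversion: summing against the inverse character leaves the index
  \<open>l = k\<close> by orthogonality, and the scalar in front removes \<open>m\<close> and the
  weight of \<open>\<epsilon>\<close>.\<close>

lemma F_inverse:
  assumes "x \<in> D" "k < m"
  shows "s (\<beta> ^ k * qfact \<zeta> k / of_nat m) (\<Sum>i<m. s (\<zeta> ^ (i * k)) (F x i)) = coord k x"
proof -
  have "(\<Sum>i<m. s (\<zeta> ^ (i * k)) (F x i))
      = (\<Sum>i<m. \<Sum>l<m. s (\<zeta> ^ (i * k) * \<epsilon> i l) (coord l x))"
    by (simp add: F_def vs.scale_sum_right)
  also have "\<dots> = (\<Sum>l<m. \<Sum>i<m. s (\<zeta> ^ (i * k) * \<epsilon> i l) (coord l x))"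
    by (rule sum.swap)
  also have "\<dots> = (\<Sum>l<m. s ((\<Sum>i<m. \<zeta> ^ (i * k) / \<zeta> ^ (i * l)) / (\<beta> ^ l * qfact \<zeta> l)) (coord l x))"
    by (simp add: \<epsilon>_def vs.scale_sum_left[symmetric] sum_divide_distrib)
  also have "\<dots> = (\<Sum>l<m. if l = k then s (of_nat m / (\<beta> ^ k * qfact \<zeta> k)) (coord k x) else 0)"
    using assms(2) by (intro sum.cong) (auto simp: character_orthogonality)
  finally show ?thesis
    using assms(2) \<beta>_neq_0 qfact_neq_0[OF assms(2)] of_nat_m_neq_0 by simp
qed

lemma F_bij: "bij_betw F D E"
  unfolding bij_betw_def
proof
  show "inj_on F D"
  proof
    fix x y assume xy: "x \<in> D" "y \<in> D" "F x = F y"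
    show "x = y"
      using xy F_inverse[OF xy(1)] F_inverse[OF xy(2)] by (intro D_eqI) auto
  qed
  show "F ` D = E"
  proof
    show "F ` D \<subseteq> E"
      using F_closed by blast
    show "E \<subseteq> F ` D"
    proof
      fix y assume y: "y \<in> E"
      \<comment> \<open>The coordinates of a preimage, read off from \<open>F_inverse\<close> with
        \<open>y\<close> in place of \<open>F x\<close>.\<close>
      define b where "b k = s (\<beta> ^ k * qfact \<zeta> k / of_nat m) (\<Sum>i<m. s (\<zeta> ^ (i * k)) (y i))" for k
      define x where "x k = (if k < m then \<psi> k (b k) else 0)" for k
      have b: "b k \<in> carrier B" for k
        using y unfolding b_def by (intro smul_closed sum_closed) (auto simp: dsum_def)
      have x: "x \<in> D"
        by (auto simp: x_def dsum_def \<psi>_closed b)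
      have coord_x: "coord k x = b k" if "k < m" for k
        using that b by (intro coord_eqI) (auto simp: x_def)
      have "F x i = y i" for i
      proof (cases "i < m")
        case True
        have "F x i = (\<Sum>k<m. s (\<epsilon> i k) (b k))"
          using True coord_x by (simp add: F_def)
        \<comment> \<open>The weights in \<open>b\<close> cancel those in \<open>\<epsilon>\<close>;
          only characters and the factor \<open>1 / m\<close> remain.\<close>
        also have "\<dots> = (\<Sum>k<m. \<Sum>j<m. s (\<zeta> ^ (k * j) / \<zeta> ^ (k * i) / of_nat m) (y j))"
          using \<beta>_neq_0 qfact_neq_0
          by (auto simp: b_def vs.scale_sum_right \<epsilon>_def mult.commute[of i] mult.commute[of _ "_::nat"]
              intro!: sum.cong)
        also have "\<dots> = (\<Sum>j<m. \<Sum>k<m. s (\<zeta> ^ (k * j) / \<zeta> ^ (k * i) / of_nat m) (y j))"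
          by (rule sum.swap)
        also have "\<dots> = (\<Sum>j<m. s ((\<Sum>k<m. \<zeta> ^ (k * j) / \<zeta> ^ (k * i)) / of_nat m) (y j))"
          by (simp add: vs.scale_sum_left[symmetric] sum_divide_distrib)
        also have "\<dots> = (\<Sum>j<m. if j = i then y i else 0)"
          using True of_nat_m_neq_0 by (intro sum.cong) (auto simp: character_orthogonality)
        also have "\<dots> = y i"
          using True by simp
        finally show ?thesis .
      qed (use y in \<open>simp add: F_def dsum_def\<close>)
      then have "y = F x"
        by auto
      then show "y \<in> F ` D"
        using x by blast
    qed
  qed
qed

text \<open>On the graded side \<open>c\<close> multiplies coordinate \<open>k\<close> by
  \<open>\<zeta> ^ k\<close>, and this factor turns \<open>\<epsilon> i k\<close> into
  \<open>\<epsilon> (i - 1) k\<close>, with \<open>i - 1\<close> read cyclically.\<close>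

lemma F_c:
  assumes "x \<in> D"
  shows "F (L_gamma_c m \<zeta> s x) = L_alpha_c m (F x)"
proof
  fix i
  have shift: "(\<Sum>k<m. s (\<epsilon> i k) (coord k (L_gamma_c m \<zeta> s x)))
      = (\<Sum>k<m. s (\<epsilon> i k * \<zeta> ^ k) (coord k x))"
    using assms by (simp add: coord_L_gamma_c)
  show "F (L_gamma_c m \<zeta> s x) i = L_alpha_c m (F x) i"
    using shift m_pos by (cases i) (simp_all add: F_def L_alpha_c_def \<epsilon>_cyclic \<epsilon>_Suc_left)
qed

text \<open>Up to a scalar depending on the position, \<open>v\<close> is \<open>1 - c\<close>;
  facts about \<open>c\<close> thereby carry over to \<open>v\<close>.\<close>

lemma L_alpha_v_eq:
  "L_alpha_v m \<zeta> \<alpha> s y i = (if i < m then s (\<alpha> * \<zeta> ^ i) (y i - L_alpha_c m y i) else 0)"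
  by (simp add: L_alpha_v_def L_alpha_c_def)

lemma F_v:
  assumes x: "x \<in> D"
  shows "F (L_gamma_v m W \<phi> x) = L_alpha_v m \<zeta> \<alpha> s (F x)"
proof
  fix i
  show "F (L_gamma_v m W \<phi> x) i = L_alpha_v m \<zeta> \<alpha> s (F x) i"
  proof (cases "i < m")
    case i: True
    have shift: "(\<Sum>k<m. g k) = g 0 + (\<Sum>k<m - 1. g (Suc k))"
      and last: "(\<Sum>k<m. g k) = (\<Sum>k<m - 1. g k) + g (m - 1)" for g :: "nat \<Rightarrow> 'b"
      using m_pos sum.lessThan_Suc_shift[of g "m - 1"] sum.lessThan_Suc[of g "m - 1"] by simp_all
    have "L_alpha_v m \<zeta> \<alpha> s (F x) i = s (\<alpha> * \<zeta> ^ i) (F x i - F (L_gamma_c m \<zeta> s x) i)"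
      using i by (simp add: L_alpha_v_eq F_c[OF x])
    also have "\<dots> = (\<Sum>k<m. s (\<alpha> * (\<zeta> ^ i * (\<epsilon> i k - \<epsilon> i k * \<zeta> ^ k))) (coord k x))"
      using i x by (simp add: F_def coord_L_gamma_c vs.scale_sum_right vs.scale_right_diff_distrib
          sum_subtractf[symmetric] vs.scale_left_diff_distrib right_diff_distrib mult.assoc)
    \<comment> \<open>The term \<open>k = 0\<close> drops out because
      \<open>1 - \<zeta> ^ 0 = 0\<close>.\<close>
    also have "\<dots> = (\<Sum>k<m - 1. s (\<epsilon> i k) (coord (Suc k) x))"
      unfolding shift by (simp add: \<epsilon>_Suc_right del: power_Suc)
    \<comment> \<open>The added term \<open>k = m - 1\<close> is zero, since \<open>v\<close> leaves
      nothing in the top degree.\<close>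
    also have "\<dots> = (\<Sum>k<m. s (\<epsilon> i k) (coord k (L_gamma_v m W \<phi> x)))"
      unfolding last using x m_pos by (auto simp: coord_L_gamma_v intro!: sum.cong)
    finally show ?thesis
      using i by (simp add: F_def)
  qed (simp add: F_def L_alpha_v_def)
qed

lemma L_gamma_bracket_closed:
  assumes "x \<in> D" "y \<in> D"
  shows "L_gamma_bracket m \<zeta> \<gamma> B \<phi> x y \<in> D"
  unfolding L_gamma_bracket_def Let_def using assms
  by (intro dv.subspace_sum subspace_D L_gamma_bracket_term_closed bracket_closed coord_closed) auto

text \<open>Expand over pairs of coordinates. In both cases of the bracket the structure constant
  combines with the scalar of the target degree to \<open>\<epsilon> i k * \<epsilon> i l\<close>,
  so at each position \<open>i\<close> the double sum factors into one bracket in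
  \<open>B\<close>.\<close>

lemma F_bracket:
  assumes x: "x \<in> D" and y: "y \<in> D"
  shows "F (bracket M x y) = bracket N (F x) (F y)"
proof
  fix i
  show "F (bracket M x y) i = bracket N (F x) (F y) i"
  proof (cases "i < m")
    case i: True
    define \<gamma> where "\<gamma> = 1 / (\<alpha> ^ m * (1 - \<zeta>) ^ m)"
    define t where "t k l = (let ab = bracket B (coord k x) (coord l y)
      in if k + l < m
         then dsum_smul s (qbinom \<zeta> (k + l) k) (phi_pow m \<phi> (k + l) ab)
         else dsum_smul s (\<gamma> * (qfact \<zeta> (k + l - m) / (qfact \<zeta> k * qfact \<zeta> l)))
                (phi_pow m \<phi> (k + l - m) ab))" for k l
    have ab: "bracket B (coord k x) (coord l y) \<in> carrier B" if "k < m" "l < m" for k l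
      using that x y by (simp add: bracket_closed coord_closed)
    have t_closed: "t k l \<in> D" if "k < m" "l < m" for k l
      unfolding t_def Let_def using that ab by (intro L_gamma_bracket_term_closed)
    have F_t: "F (t k l) i = s (\<epsilon> i k * \<epsilon> i l) (bracket B (coord k x) (coord l y))"
      if kl: "k < m" "l < m" for k l
    proof -
      have F_smul: "F (dsum_smul s r z) i = s r (F z i)" if "z \<in> D" for r z
        using F_linear that by (simp add: linear_on_sub_def dsum_smul_def)
      show ?thesis
        using kl i ab[OF kl]
        by (simp add: t_def Let_def F_smul phi_pow_closed F_phi_pow \<epsilon>_mult_less \<epsilon>_mult_ge
            \<gamma>_def del: times_divide_eq_left times_divide_eq_right)
    qed
    have "bracket M x y = L_gamma_bracket m \<zeta> \<gamma> B \<phi> x y"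
      by (simp add: L_gamma_def \<gamma>_def)
    then have "F (bracket M x y) i = F (\<Sum>k<m. \<Sum>l<m. t k l) i"
      by (simp only: L_gamma_bracket_def t_def)
    also have "F (\<Sum>k<m. \<Sum>l<m. t k l) = (\<Sum>k<m. F (\<Sum>l<m. t k l))"
      using t_closed
      by (intro linear_on_sub_sum[OF F_linear vs_D vs_D subspace_D] dv.subspace_sum subspace_D) auto
    also have "\<dots> = (\<Sum>k<m. \<Sum>l<m. F (t k l))"
      using t_closed
      by (intro sum.cong linear_on_sub_sum[OF F_linear vs_D vs_D subspace_D]) auto
    also have "\<dots> i = (\<Sum>k<m. \<Sum>l<m. s (\<epsilon> i k * \<epsilon> i l) (bracket B (coord k x) (coord l y)))"
      by (simp add: sum_apply F_t)
    also have "\<dots> = (\<Sum>k<m. \<Sum>l<m. bracket B (s (\<epsilon> i k) (coord k x)) (s (\<epsilon> i l) (coord l y)))"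
      using x y by (intro sum.cong)
        (simp_all add: bracket_smul_left bracket_smul_right smul_closed coord_closed)
    also have "\<dots> = (\<Sum>k<m. bracket B (s (\<epsilon> i k) (coord k x)) (\<Sum>l<m. s (\<epsilon> i l) (coord l y)))"
      using x y by (intro sum.cong bracket_sum_right[symmetric])
        (simp_all add: smul_closed coord_closed)
    also have "\<dots> = bracket B (\<Sum>k<m. s (\<epsilon> i k) (coord k x)) (\<Sum>l<m. s (\<epsilon> i l) (coord l y))"
      using x y by (intro bracket_sum_left[symmetric] sum_closed)
        (simp_all add: smul_closed coord_closed)
    also have "\<dots> = bracket N (F x) (F y) i"
      using i by (simp add: L_alpha_def F_def)
    finally show ?thesis .
  qed (simp add: F_def L_alpha_def)
qed

section \<open>The Taft relations on the graded side\<close>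

lemma L_gamma_c_power: "x \<in> D \<Longrightarrow> (L_gamma_c m \<zeta> s ^^ n) x = (\<lambda>i. s (\<zeta> ^ (n * i)) (x i))"
  by (induction n) (auto simp: L_gamma_c_def dsum_def fun_eq_iff power_add)

text \<open>Each \<open>v\<close> shifts the coordinates down by one, so \<open>m\<close>
  applications leave nothing. Membership in \<open>D\<close> is carried along because the coordinate
  formula holds only there.\<close>

lemma coord_L_gamma_v_power:
  "\<lbrakk>x \<in> D; k < m\<rbrakk> \<Longrightarrow> (L_gamma_v m W \<phi> ^^ n) x \<in> D \<and>
    coord k ((L_gamma_v m W \<phi> ^^ n) x) = (if k + n < m then coord (k + n) x else 0)"
  by (induction n arbitrary: k) (auto simp: L_gamma_v_closed coord_L_gamma_v)

lemma zero_D: "0 \<in> D"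
  using subspace_D by (rule dv.subspace_0)

lemma coord_zero: "k < m \<Longrightarrow> coord k 0 = 0"
  by (rule coord_eqI) (auto simp: zero_closed)

lemma L_gamma_v_power_m:
  assumes "x \<in> D"
  shows "(L_gamma_v m W \<phi> ^^ m) x = 0"
  using coord_L_gamma_v_power[OF assms, of _ m] m_pos
  by (intro D_eqI zero_D) (auto simp: coord_zero)

text \<open>Coordinate \<open>k\<close> of either side is \<open>\<zeta> ^ Suc k\<close> times
  coordinate \<open>Suc k\<close> of \<open>x\<close>, or zero in the top degree.\<close>

lemma L_gamma_v_c:
  assumes "x \<in> D"
  shows "L_gamma_v m W \<phi> (L_gamma_c m \<zeta> s x)
    = dsum_smul s \<zeta> (L_gamma_c m \<zeta> s (L_gamma_v m W \<phi> x))"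
  using assms
  by (intro D_eqI)
    (auto simp: L_gamma_v_closed L_gamma_c_closed dv.subspace_scale[OF subspace_D] coord_L_gamma_v
      coord_L_gamma_c coord_smul)

section \<open>Lie axioms on the componentwise side, linearity, and the Leibniz rules\<close>

lemma lie_algebra_L_alpha: "lie_algebra N"
proof (rule lie_algebra.intro)
  show "vector_space (smul N)"
    using vs_D by (simp add: L_alpha_def)
  show "module.subspace (smul N) (carrier N)"
    using subspace_dsum[OF vector_space subspace] by (simp add: L_alpha_def)
qed (auto simp: L_alpha_def dsum_def dsum_smul_def fun_eq_iff bracket_closed bracket_add_left
    bracket_add_right bracket_smul_left bracket_smul_right bracket_self jacobi)

lemma L_gamma_c_linear: "linear_on_sub (dsum_smul s) (dsum_smul s) D (L_gamma_c m \<zeta> s)"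
  by (auto simp: linear_on_sub_def L_gamma_c_def dsum_smul_def fun_eq_iff vs.scale_right_distrib
      mult.commute)

lemma L_gamma_v_linear: "linear_on_sub (dsum_smul s) (dsum_smul s) D (L_gamma_v m W \<phi>)"
  unfolding linear_on_sub_def
  by (auto intro!: D_eqI dv.subspace_add[OF subspace_D] dv.subspace_scale[OF subspace_D]
      simp: L_gamma_v_closed coord_L_gamma_v coord_add coord_smul dv.subspace_add[OF subspace_D]
        dv.subspace_scale[OF subspace_D])

lemma L_alpha_c_bracket: "L_alpha_c m (bracket N a b) = bracket N (L_alpha_c m a) (L_alpha_c m b)"
  by (auto simp: L_alpha_def L_alpha_c_def fun_eq_iff)

lemma L_alpha_c_closed: "a \<in> E \<Longrightarrow> L_alpha_c m a \<in> E"
  by (auto simp: dsum_def L_alpha_c_def)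

lemma bracket_diff_left:
  "\<lbrakk>a \<in> carrier B; b \<in> carrier B; c \<in> carrier B\<rbrakk> \<Longrightarrow>
    bracket B (a - b) c = bracket B a c - bracket B b c"
  using bracket_add_left[of "a - b" b c] vs.subspace_diff[OF subspace] by (simp add: algebra_simps)

lemma bracket_diff_right:
  "\<lbrakk>a \<in> carrier B; b \<in> carrier B; c \<in> carrier B\<rbrakk> \<Longrightarrow>
    bracket B c (a - b) = bracket B c a - bracket B c b"
  using bracket_add_right[of c "a - b" b] vs.subspace_diff[OF subspace] by (simp add: algebra_simps)

text \<open>Since \<open>v\<close> is a multiple of \<open>1 - c\<close> and \<open>c\<close>
  respects brackets, this is the identity
  \<open>[a, b] - [ca, cb] = [ca, b - cb] + [a - ca, b]\<close> at each position.\<close>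

lemma L_alpha_v_bracket:
  assumes "a \<in> E" "b \<in> E"
  shows "L_alpha_v m \<zeta> \<alpha> s (bracket N a b) =
    bracket N (L_alpha_c m a) (L_alpha_v m \<zeta> \<alpha> s b) + bracket N (L_alpha_v m \<zeta> \<alpha> s a) b"
proof
  fix i
  have *: "a i \<in> carrier B" "b i \<in> carrier B" "L_alpha_c m a i \<in> carrier B"
    "L_alpha_c m b i \<in> carrier B" if "i < m"
    using that assms L_alpha_c_closed by (auto simp: dsum_def)
  show "L_alpha_v m \<zeta> \<alpha> s (bracket N a b) i =
    (bracket N (L_alpha_c m a) (L_alpha_v m \<zeta> \<alpha> s b) + bracket N (L_alpha_v m \<zeta> \<alpha> s a) b) i"
  proof (cases "i < m")
    case True
    have "L_alpha_v m \<zeta> \<alpha> s (bracket N a b) i = s (\<alpha> * \<zeta> ^ i)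
        (bracket B (a i) (b i) - bracket B (L_alpha_c m a i) (L_alpha_c m b i))"
      using True by (simp only: L_alpha_v_eq L_alpha_c_bracket) (simp add: L_alpha_def)
    also have "\<dots> = s (\<alpha> * \<zeta> ^ i) (bracket B (L_alpha_c m a i) (b i - L_alpha_c m b i)
        + bracket B (a i - L_alpha_c m a i) (b i))"
      using True * by (simp add: bracket_diff_left bracket_diff_right)
    also have "\<dots> = bracket B (L_alpha_c m a i) (L_alpha_v m \<zeta> \<alpha> s b i)
        + bracket B (L_alpha_v m \<zeta> \<alpha> s a i) (b i)"
      using True * by (simp add: L_alpha_v_eq bracket_smul_left bracket_smul_right
          vs.subspace_diff[OF subspace] vs.scale_right_distrib)
    finally show ?thesis
      using True by (simp add: L_alpha_def)
  qed (simp add: L_alpha_v_def L_alpha_def)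
qed

text \<open>In \<open>M\<close> the operator \<open>c\<close> is diagonal and \<open>v\<close> a
  shift of coordinates, which makes the Taft relations easy; in \<open>N\<close> the bracket is
  componentwise, which makes the Lie axioms and Leibniz rules easy. \<open>F\<close> carries each to
  the other side.\<close>

lemma L_gamma_isomorphic_L_alpha: "taft_lie_isomorphic m \<zeta> M N"
proof (rule taft_lie_isomorphicI[where f = F
      and C = "L_gamma_c m \<zeta> s" and V = "L_gamma_v m W \<phi>"
      and C' = "L_alpha_c m" and V' = "L_alpha_v m \<zeta> \<alpha> s"])
  show "lie_algebra N"
    by (rule lie_algebra_L_alpha)
  show "case_taft_gen (L_gamma_c m \<zeta> s) (L_gamma_v m W \<phi>) g x \<in> carrier M"
    "F (case_taft_gen (L_gamma_c m \<zeta> s) (L_gamma_v m W \<phi>) g x)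
      = case_taft_gen (L_alpha_c m) (L_alpha_v m \<zeta> \<alpha> s) g (F x)"
    if "x \<in> carrier M" for g x
    using that
    by (cases g; simp add: L_gamma_def L_gamma_c_closed L_gamma_v_closed F_c F_v)+
  show "linear_on_sub (smul M) (smul M) (carrier M)
      (case_taft_gen (L_gamma_c m \<zeta> s) (L_gamma_v m W \<phi>) g)" for g
    by (cases g) (simp_all add: L_gamma_def L_gamma_c_linear L_gamma_v_linear)
  show "(L_gamma_c m \<zeta> s ^^ m) x = x" if "x \<in> carrier M" for x
    using that by (simp add: L_gamma_def L_gamma_c_power power_mult)
  show "F (bracket M x y) = bracket N (F x) (F y)" if "x \<in> carrier M" "y \<in> carrier M" for x y
    using that by (intro F_bracket) (simp_all add: L_gamma_def)
  show "bracket M x y \<in> carrier M" if "x \<in> carrier M" "y \<in> carrier M" for x y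
    using that L_gamma_bracket_closed by (simp add: L_gamma_def)
  show "L_alpha_c m (bracket N x y) = bracket N (L_alpha_c m x) (L_alpha_c m y)" for x y
    by (rule L_alpha_c_bracket)
  show "L_alpha_v m \<zeta> \<alpha> s (bracket N x y)
      = bracket N (L_alpha_c m x) (L_alpha_v m \<zeta> \<alpha> s y) + bracket N (L_alpha_v m \<zeta> \<alpha> s x) y"
    if "x \<in> carrier N" "y \<in> carrier N" for x y
    using that by (intro L_alpha_v_bracket) (simp_all add: L_alpha_def)
qed (use F_bij F_linear vs_D subspace_D L_gamma_v_power_m L_gamma_v_c
    in \<open>simp_all add: L_gamma_def L_alpha_def\<close>)

end

theorem theorem4p3:
  fixes m :: nat and \<zeta> \<alpha> :: "'f::field"
    and B :: "('f, 'b::ab_group_add) lie_struct"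
    and L :: "nat \<Rightarrow> 'b set" and \<phi> :: "nat \<Rightarrow> 'b \<Rightarrow> 'b"
  assumes "m \<ge> 2"
    and "simple_lie_algebra B"
    and "primitive_root_of_unity m \<zeta>"
    and "\<alpha> \<noteq> 0"
    and "phi_data m B L \<phi>"
  shows "taft_lie_isomorphic m \<zeta>
    (L_gamma m \<zeta> (1 / (\<alpha> ^ m * (1 - \<zeta>) ^ m)) B L \<phi>)
    (L_alpha m \<zeta> \<alpha> B)"
proof -
  interpret simple_lie_algebra B by fact
  interpret L_alpha_L_gamma m \<zeta> \<alpha> B L \<phi>
    by standard (use assms in auto)
  show ?thesis
    by (rule L_gamma_isomorphic_L_alpha)
qed

end
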